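(* Let $\Omega\subset\mathbb C^n$ be a bounded open set and $1\le m\le n-1$. There exists a uniform constant $C$ depending on $\omega,n,m$ such that for every $\gamma\in\Gamma_m(\omega)$, every smooth real-valued function $h$ on $\Omega$ and all Borel functions $\phi,\psi$ on $\Omega$, $$\left|\int\phi\psi\,dh\wedge d^c\omega\wedge\gamma^{m-1}\wedge\omega^{n-m-1}\right|^2\le C\int|\phi|^2\,dh\wedge d^ch\wedge\gamma^{m-1}\wedge\omega^{n-m}\ \times\int|\psi|^2\,\gamma^{m-1}\wedge\omega^{n-m+1},$$ where all integrals are over $\Omega$.
   Context: $\omega$ is a smooth Hermitian metric (positive $(1,1)$-form) on $\mathbb C^n$, not assumed closed. $d^c=\sqrt{-1}(\bar\partial-\partial)$ (up to a fixed positive normalization). $\Gamma_m(\omega)$ is the set of (smooth) real $(1,1)$-forms $\gamma$ on $\Omega$ with $\gamma^k\wedge\omega^{n-k}>0$ at every point of $\Omega$ for $k=1,\dots,m$.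
   Formalization: The constant C is allowed to depend on the fixed bounded open set Ω as well as on ω, n, m; for a general smooth ω on C^n a constant independent of Ω does not exist, since the torsion of ω may be unbounded on C^n. *)

theory Defs
  imports "HOL-Analysis.Analysis"
begin

section \<open>Smooth functions\<close>

text \<open>For an open \<open>S\<close> in a Euclidean space this is the usual notion of \<open>k\<close>-fold continuous
  differentiability: all iterated directional derivatives of order up to \<open>k\<close> exist and are
  continuous.\<close>

primrec Ck_on :: "nat \<Rightarrow> 'a::euclidean_space set \<Rightarrow> ('a \<Rightarrow> 'b::real_normed_vector) \<Rightarrow> bool" where
  "Ck_on 0 S f \<longleftrightarrow> continuous_on S f"
| "Ck_on (Suc k) S f \<longleftrightarrow>
     (\<forall>x\<in>S. f differentiable (at x)) \<and> (\<forall>v. Ck_on k S (\<lambda>x. frechet_derivative f (at x) v))"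

definition smooth_on :: "'a::euclidean_space set \<Rightarrow> ('a \<Rightarrow> 'b::real_normed_vector) \<Rightarrow> bool" where
  "smooth_on S f \<longleftrightarrow> (\<forall>k. Ck_on k S f)"


section \<open>The exterior algebra at a point\<close>

text \<open>An element \<open>a\<close> of the complexified exterior algebra of the cotangent space of
  \<open>\<complex>\<^sup>n\<close> is given by its coefficients: \<open>a I J\<close> is the coefficient of
  \<open>dz\<^sub>I \<and> d\<bar>z\<^sub>J\<close>, where \<open>I\<close> and \<open>J\<close> are listed in increasing order and all \<open>dz\<close>'s precede
  all \<open>d\<bar>z\<close>'s.  The linear order on the index type serves only to fix these signs.\<close>

type_synonym 'n ext = "'n set \<Rightarrow> 'n set \<Rightarrow> complex"

text \<open>For disjoint \<open>I\<close>, \<open>K\<close>: \<open>dz\<^sub>I \<and> dz\<^sub>K = shuffle_sign I K \<cdot> dz\<^bsub>I \<union> K\<^esub>\<close>.\<close>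

definition shuffle_sign :: "'n::linorder set \<Rightarrow> 'n set \<Rightarrow> complex" where
  "shuffle_sign I K = (- 1) ^ card {(i, k). i \<in> I \<and> k \<in> K \<and> k < i}"

text \<open>The factor \<open>(- 1) ^ (card B * card (I - A))\<close> comes from moving \<open>dz\<^bsub>I - A\<^esub>\<close> to the left
  past \<open>d\<bar>z\<^sub>B\<close>.\<close>

definition ext_wedge :: "'n::{finite,linorder} ext \<Rightarrow> 'n ext \<Rightarrow> 'n ext" where
  "ext_wedge a b = (\<lambda>I J. \<Sum>A\<in>Pow I. \<Sum>B\<in>Pow J.
     (- 1) ^ (card B * card (I - A)) * shuffle_sign A (I - A) * shuffle_sign B (J - B)
       * a A B * b (I - A) (J - B))"

definition ext_one :: "'n ext" where
  "ext_one = (\<lambda>I J. if I = {} \<and> J = {} then 1 else 0)"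

definition ext_dz :: "'n \<Rightarrow> 'n ext" where
  "ext_dz j = (\<lambda>I J. if I = {j} \<and> J = {} then 1 else 0)"

definition ext_dzbar :: "'n \<Rightarrow> 'n ext" where
  "ext_dzbar j = (\<lambda>I J. if I = {} \<and> J = {j} then 1 else 0)"

text \<open>The conjugate of \<open>dz\<^sub>J \<and> d\<bar>z\<^sub>I\<close> is
  \<open>d\<bar>z\<^sub>J \<and> dz\<^sub>I = (- 1)\<^bsup>|I| |J|\<^esup> dz\<^sub>I \<and> d\<bar>z\<^sub>J\<close>.\<close>

definition ext_cnj :: "'n ext \<Rightarrow> 'n ext" where
  "ext_cnj a = (\<lambda>I J. (- 1) ^ (card I * card J) * cnj (a J I))"

text \<open>The density of the top-degree part with respect to
  \<open>dx\<^sub>1 \<and> dy\<^sub>1 \<and> \<dots> \<and> dx\<^sub>n \<and> dy\<^sub>n\<close>, the product over \<open>j\<close> of the \<open>(\<i>/2) dz\<^sub>j \<and> d\<bar>z\<^sub>j\<close>,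
  which equals \<open>(\<i>/2)\<^sup>n (- 1)\<^bsup>n (n - 1) / 2\<^esup> dz\<^sub>1 \<and> \<dots> \<and> dz\<^sub>n \<and> d\<bar>z\<^sub>1 \<and> \<dots> \<and> d\<bar>z\<^sub>n\<close>.\<close>

definition ext_density :: "'n::finite ext \<Rightarrow> complex" where
  "ext_density a = a UNIV UNIV /
     ((\<i> / 2) ^ CARD('n) * (- 1) ^ (CARD('n) * (CARD('n) - 1) div 2))"


section \<open>Differential forms\<close>

type_synonym 'n form = "complex ^ 'n \<Rightarrow> 'n ext"

definition form_wedge :: "'n::{finite,linorder} form \<Rightarrow> 'n form \<Rightarrow> 'n form"
    (infixr \<open>\<and>\<^sub>F\<close> 70) where
  "\<alpha> \<and>\<^sub>F \<beta> = (\<lambda>z. ext_wedge (\<alpha> z) (\<beta> z))"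

primrec form_pow :: "'n::{finite,linorder} form \<Rightarrow> nat \<Rightarrow> 'n form" (infixr \<open>^\<^sub>F\<close> 80) where
  "\<alpha> ^\<^sub>F 0 = (\<lambda>z. ext_one)"
| "\<alpha> ^\<^sub>F Suc k = \<alpha> \<and>\<^sub>F (\<alpha> ^\<^sub>F k)"

definition form_scale :: "(complex ^ 'n \<Rightarrow> complex) \<Rightarrow> 'n form \<Rightarrow> 'n form"
    (infixr \<open>\<cdot>\<^sub>F\<close> 65) where
  "f \<cdot>\<^sub>F \<alpha> = (\<lambda>z I J. f z * \<alpha> z I J)"

definition form_of_real_fun :: "(complex ^ 'n \<Rightarrow> real) \<Rightarrow> 'n form" where
  "form_of_real_fun h = (\<lambda>z I J. complex_of_real (h z) * ext_one I J)"

definition smooth_form_on :: "(complex ^ 'n::finite) set \<Rightarrow> 'n form \<Rightarrow> bool" where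
  "smooth_form_on S \<alpha> \<longleftrightarrow> (\<forall>I J. smooth_on S (\<lambda>z. \<alpha> z I J))"

definition real_11_form_on :: "(complex ^ 'n::finite) set \<Rightarrow> 'n form \<Rightarrow> bool" where
  "real_11_form_on S \<alpha> \<longleftrightarrow>
     (\<forall>z\<in>S. (\<forall>I J. \<alpha> z I J \<noteq> 0 \<longrightarrow> card I = 1 \<and> card J = 1) \<and> ext_cnj (\<alpha> z) = \<alpha> z)"

text \<open>The Wirtinger derivatives \<open>\<partial>/\<partial>z\<^sub>j\<close> and \<open>\<partial>/\<partial>\<bar>z\<^sub>j\<close>; the vectors \<open>axis j 1\<close> and
  \<open>axis j \<i>\<close> are the real coordinate directions \<open>x\<^sub>j\<close> and \<open>y\<^sub>j\<close>.\<close>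

definition wirt :: "'n::finite \<Rightarrow> (complex ^ 'n \<Rightarrow> complex) \<Rightarrow> complex ^ 'n \<Rightarrow> complex" where
  "wirt j f z =
     (frechet_derivative f (at z) (axis j 1) - \<i> * frechet_derivative f (at z) (axis j \<i>)) / 2"

definition wirt_bar :: "'n::finite \<Rightarrow> (complex ^ 'n \<Rightarrow> complex) \<Rightarrow> complex ^ 'n \<Rightarrow> complex" where
  "wirt_bar j f z =
     (frechet_derivative f (at z) (axis j 1) + \<i> * frechet_derivative f (at z) (axis j \<i>)) / 2"

definition form_del :: "'n::{finite,linorder} form \<Rightarrow> 'n form" where
  "form_del \<alpha> = (\<lambda>z I J. \<Sum>j\<in>UNIV. ext_wedge (ext_dz j) (\<lambda>K L. wirt j (\<lambda>w. \<alpha> w K L) z) I J)"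

definition form_delbar :: "'n::{finite,linorder} form \<Rightarrow> 'n form" where
  "form_delbar \<alpha> =
     (\<lambda>z I J. \<Sum>j\<in>UNIV. ext_wedge (ext_dzbar j) (\<lambda>K L. wirt_bar j (\<lambda>w. \<alpha> w K L) z) I J)"

definition form_d :: "'n::{finite,linorder} form \<Rightarrow> 'n form" where
  "form_d \<alpha> = (\<lambda>z I J. form_del \<alpha> z I J + form_delbar \<alpha> z I J)"

definition form_dc :: "'n::{finite,linorder} form \<Rightarrow> 'n form" where
  "form_dc \<alpha> = (\<lambda>z I J. \<i> * (form_delbar \<alpha> z I J - form_del \<alpha> z I J))"


section \<open>Hermitian metrics and the cone \<open>\<Gamma>\<^sub>m(\<omega>)\<close>\<close>

text \<open>Writing \<open>\<omega> = \<i> \<Sum> g\<^sub>i\<^sub>j dz\<^sub>i \<and> d\<bar>z\<^sub>j\<close>, positivity of \<open>\<omega>\<close> means that the matrix \<open>g\<close>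
  (Hermitian, since \<open>\<omega>\<close> is real) is positive definite.\<close>

definition hermitian_metric :: "'n::finite form \<Rightarrow> bool" where
  "hermitian_metric \<omega> \<longleftrightarrow> smooth_form_on UNIV \<omega> \<and> real_11_form_on UNIV \<omega> \<and>
     (\<forall>z v. v \<noteq> 0 \<longrightarrow>
        0 < Re (\<Sum>i\<in>UNIV. \<Sum>j\<in>UNIV. (\<omega> z {i} {j} / \<i>) * v $ i * cnj (v $ j)))"

text \<open>The density of a real top-degree form is real, so taking the real part loses nothing.\<close>

definition Gamma_cone ::
    "(complex ^ 'n::{finite,linorder}) set \<Rightarrow> 'n form \<Rightarrow> nat \<Rightarrow> 'n form set" where
  "Gamma_cone \<Omega> \<omega> m = {\<gamma>. smooth_form_on \<Omega> \<gamma> \<and> real_11_form_on \<Omega> \<gamma> \<and>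
     (\<forall>k\<in>{1..m}. \<forall>z\<in>\<Omega>. 0 < Re (ext_density ((\<gamma> ^\<^sub>F k \<and>\<^sub>F \<omega> ^\<^sub>F (CARD('n) - k)) z)))}"


section \<open>Integration of top-degree forms\<close>

definition form_integrable :: "(complex ^ 'n::finite) set \<Rightarrow> 'n form \<Rightarrow> bool" where
  "form_integrable \<Omega> \<alpha> \<longleftrightarrow> set_integrable lborel \<Omega> (\<lambda>z. ext_density (\<alpha> z))"

definition form_integral :: "(complex ^ 'n::finite) set \<Rightarrow> 'n form \<Rightarrow> complex" where
  "form_integral \<Omega> \<alpha> = (LINT z:\<Omega>|lborel. ext_density (\<alpha> z))"

text \<open>The extended-real-valued integral of a real form, used for nonnegative forms whose integral
  may be infinite.\<close>

definition form_integral_ereal :: "(complex ^ 'n::finite) set \<Rightarrow> 'n form \<Rightarrow> ereal" where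
  "form_integral_ereal \<Omega> \<alpha> =
     enn2ereal (\<integral>\<^sup>+z\<in>\<Omega>. ennreal (Re (ext_density (\<alpha> z))) \<partial>lborel)
     - enn2ereal (\<integral>\<^sup>+z\<in>\<Omega>. ennreal (- Re (ext_density (\<alpha> z))) \<partial>lborel)"

end

theory Submission
  imports Defs "HOL-Computational_Algebra.Fundamental_Theorem_Algebra"
begin

text \<open>The inequality holds already at every point, and the integrals are compared by Cauchy--Schwarz.
Let \<open>f\<close>, \<open>A\<close> and \<open>B\<close> be the densities of the three top-degree forms without the factors \<open>\<phi>\<close> and
\<open>\<psi>\<close>.  If \<open>A\<close> and \<open>B\<close> are nonnegative and \<open>|f|\<^sup>2 \<le> C A B\<close> on \<open>\<Omega>\<close>, then
\<open>|\<phi> \<psi> f| \<le> C\<^bsup>1/2\<^esup> (|\<phi>| A\<^bsup>1/2\<^esup>) (|\<psi>| B\<^bsup>1/2\<^esup>)\<close>, and Cauchy--Schwarz for extended nonnegative integrals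
(\<open>weighted_Cauchy_Schwarz\<close>) gives the claim, with integrability of the left-hand side whenever the
right-hand side is finite.

For the pointwise bound, fix a point and choose a basis \<open>\<theta>\<^sub>1, \<dots>, \<theta>\<^sub>n\<close> of the \<open>(1,0)\<close>-forms in which
\<open>\<omega> = \<Sum> \<i> \<theta>\<^sub>p \<and> \<theta>\<^sub>p*\<close> and \<open>\<gamma> = \<Sum> \<lambda>\<^sub>p \<i> \<theta>\<^sub>p \<and> \<theta>\<^sub>p*\<close>, where \<open>*\<close> is complex conjugation
(\<open>unitary_coframe_exists\<close>).  Write \<open>e\<^sub>k(\<lambda>|J)\<close> for the elementary symmetric function of the \<open>\<lambda>\<^sub>i\<close> with
\<open>i \<notin> J\<close>, and \<open>\<partial>h = \<Sum> b\<^sub>p \<theta>\<^sub>p\<close>.  The powers of \<open>\<gamma>\<close> and \<open>\<omega>\<close> are then explicit, and up to factorials and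
the density of the volume form \<open>\<Prod> \<i> \<theta>\<^sub>p \<and> \<theta>\<^sub>p*\<close>
  \<^item> \<open>A\<close> is \<open>\<Sum> |b\<^sub>p|\<^sup>2 e\<^bsub>m-1\<^esub>(\<lambda>|p)\<close> (\<open>dens_dh_dch\<close>),
  \<^item> \<open>B\<close> is \<open>e\<^bsub>m-1\<^esub>(\<lambda>)\<close> (\<open>dens_top_real\<close>),
  \<^item> \<open>f\<close> is a sum of terms \<open>b\<^sub>p \<eta> e\<^bsub>m-1\<^esub>(\<lambda>|pq)\<close> with \<open>p \<noteq> q\<close> and \<open>\<eta>\<close> a coefficient of \<open>d\<^sup>c\<omega>\<close> in the basis, or
    their conjugates: a product of four elements of the coframe and \<open>\<gamma>\<^bsup>m-1\<^esup> \<and> \<omega>\<^bsup>n-m-1\<^esup>\<close> vanishes unless the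
    four are \<open>\<theta>\<^sub>p, \<theta>\<^sub>p*, \<theta>\<^sub>q, \<theta>\<^sub>q*\<close> (\<open>theta4_mixed_bound\<close>).
The coefficients \<open>\<eta>\<close> are bounded uniformly on \<open>\<Omega>\<close>, because on the compact closure of \<open>\<Omega>\<close> the metric
\<open>\<omega>\<close> is bounded below and its first derivatives are bounded.

What remains is \<open>e\<^bsub>m-1\<^esub>(\<lambda>|pq)\<^sup>2 \<le> C e\<^bsub>m-1\<^esub>(\<lambda>|p) e\<^bsub>m-1\<^esub>(\<lambda>)\<close> when \<open>e\<^sub>1(\<lambda>), \<dots>, e\<^sub>m(\<lambda>) > 0\<close>
(\<open>esym_remove_two_bound\<close>); here \<open>e\<^bsub>m-1\<^esub>(\<lambda>|pq)\<close> need not be positive.  Put \<open>a = e\<^bsub>m-2\<^esub>(\<lambda>|pq)\<close>,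
\<open>b = e\<^bsub>m-1\<^esub>(\<lambda>|pq)\<close> and \<open>c = e\<^sub>m(\<lambda>|pq)\<close>.  Then
\<open>e\<^bsub>m-1\<^esub>(\<lambda>|p) e\<^bsub>m-1\<^esub>(\<lambda>|q) = a e\<^sub>m(\<lambda>) + (b\<^sup>2 - a c)\<close>.  The first summand is positive, and Newton's
inequality with its constant smaller than \<open>1\<close> (\<open>newton_inequality\<close>) bounds the second below by a multiple
of \<open>b\<^sup>2\<close>.  Finally \<open>e\<^bsub>m-1\<^esub>(\<lambda>|q)\<close> is at most a multiple of \<open>e\<^bsub>m-1\<^esub>(\<lambda>)\<close>, because these numbers are positive
and their sum over \<open>q\<close> is \<open>(n-m+1) e\<^bsub>m-1\<^esub>(\<lambda>)\<close>.\<close>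

section \<open>Newton's inequality\<close>

lemma of_real_poly_map_mult:
  "map_poly complex_of_real (p * q) = map_poly complex_of_real p * map_poly complex_of_real q"
  by (rule poly_eqI) (simp add: coeff_map_poly coeff_mult)

text \<open>The zero polynomial is included so that the class is closed under differentiation.\<close>

definition real_rooted :: "complex poly \<Rightarrow> bool" where
  "real_rooted p \<longleftrightarrow> p = 0 \<or> (\<forall>z. poly p z = 0 \<longrightarrow> Im z = 0)"

lemma poly_pderiv_prod_linear:
  fixes A :: "complex multiset"
  assumes "\<forall>x\<in>#A. z \<noteq> x"
  shows "poly (pderiv (\<Prod>x\<in>#A. [:-x, 1:])) z
      = poly (\<Prod>x\<in>#A. [:-x, 1:]) z * (\<Sum>x\<in>#A. 1 / (z - x))"
  using assms
proof (induction A)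
  case (add x A)
  then show ?case
    by (simp del: mult_pCons_left add: pderiv_mult pderiv_pCons field_simps)
qed simp

text \<open>Each \<open>1 / (z - x)\<close> with \<open>x\<close> real lies in the open half plane opposite to that of \<open>z\<close>, so the logarithmic
derivative of a real-rooted polynomial has no zeros off the real axis.\<close>

lemma Im_sum_inverse_neg:
  fixes A :: "complex multiset"
  assumes "\<forall>x\<in>#A. Im x = 0" "A \<noteq> {#}" "Im z \<noteq> 0"
  shows "Im (\<Sum>x\<in>#A. 1 / (z - x)) * Im z < 0"
proof -
  have one: "Im (1 / (z - x)) * Im z < 0" if "Im x = 0" for x
  proof -
    have "Im (1 / (z - x)) * Im z = - ((Im z)\<^sup>2 / (cmod (z - x))\<^sup>2)"
      using that by (simp add: Im_divide' power2_eq_square)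
    moreover have "z \<noteq> x" using that assms(3) by auto
    ultimately show ?thesis using assms(3) by simp
  qed
  show ?thesis
    using assms(1,2)
  proof (induction A)
    case (add x A)
    show ?case
    proof (cases "A = {#}")
      case True
      then show ?thesis using one add.prems by simp
    next
      case False
      then have "Im (\<Sum>x\<in>#A. 1 / (z - x)) * Im z < 0" using add by simp
      with one[of x] add.prems show ?thesis
        by (simp add: ring_distribs)
    qed
  qed simp
qed

lemma real_rooted_pderiv:
  assumes "real_rooted p"
  shows "real_rooted (pderiv p)"
proof (cases "degree p = 0")
  case True
  then show ?thesis by (simp add: real_rooted_def pderiv_eq_0_iff)
next
  case False
  then have "p \<noteq> 0" by auto
  then obtain A where A: "size A = degree p" "p = smult (lead_coeff p) (\<Prod>x\<in>#A. [:-x, 1:])"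
    using alg_closed_imp_factorization by blast
  define c where "c = lead_coeff p"
  have c: "c \<noteq> 0" "p = smult c (\<Prod>x\<in>#A. [:-x, 1:])" using A \<open>p \<noteq> 0\<close> by (auto simp: c_def)
  have rts: "poly p x = 0" if "x \<in># A" for x
    using that c(2) by (auto simp: poly_prod_mset prod_mset_zero_iff)
  have re: "\<forall>x\<in>#A. Im x = 0"
    using rts assms \<open>p \<noteq> 0\<close> by (auto simp: real_rooted_def)
  have "Im z = 0" if z: "poly (pderiv p) z = 0" for z
  proof (rule ccontr)
    assume im: "Im z \<noteq> 0"
    then have nz: "poly p z \<noteq> 0" using assms \<open>p \<noteq> 0\<close> by (auto simp: real_rooted_def)
    have "\<forall>x\<in>#A. z \<noteq> x" using im re by auto
    then have "poly (pderiv p) z = poly p z * (\<Sum>x\<in>#A. 1 / (z - x))"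
      using poly_pderiv_prod_linear[of A z] by (subst (1 2) c(2)) (simp add: pderiv_smult)
    moreover have "(\<Sum>x\<in>#A. 1 / (z - x)) \<noteq> 0"
      using Im_sum_inverse_neg[OF re _ im] A(1) False by (metis mult_zero_left less_irrefl zero_complex.simps(2) size_empty)
    ultimately show False using nz z by simp
  qed
  then show ?thesis by (auto simp: real_rooted_def)
qed

lemma coeffs_prod_linear:
  fixes B :: "real multiset"
  shows "coeff (\<Prod>y\<in>#B. [:1, y:]) 0 = 1"
    and "coeff (\<Prod>y\<in>#B. [:1, y:]) 1 = \<Sum>\<^sub># B"
    and "2 * coeff (\<Prod>y\<in>#B. [:1, y:]) 2 = (\<Sum>\<^sub># B)\<^sup>2 - (\<Sum>y\<in>#B. y\<^sup>2)"
proof -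
  show 0: "coeff (\<Prod>y\<in>#B. [:1, y:]) 0 = 1" for B :: "real multiset"
    by (induction B) (auto simp: coeff_mult)
  show 1: "coeff (\<Prod>y\<in>#B. [:1, y:]) 1 = \<Sum>\<^sub># B" for B :: "real multiset"
    by (induction B) (auto simp: coeff_pCons 0 split: nat.splits)
  show "2 * coeff (\<Prod>y\<in>#B. [:1, y:]) 2 = (\<Sum>\<^sub># B)\<^sup>2 - (\<Sum>y\<in>#B. y\<^sup>2)"
    using 1 by (induction B) (auto simp: coeff_pCons numeral_2_eq_2 power2_eq_square algebra_simps split: nat.splits)
qed

lemma sum_mset_squares_ge:
  fixes B :: "real multiset"
  assumes "size B \<le> N" "0 < N"
  shows "(\<Sum>\<^sub># B)\<^sup>2 \<le> real N * (\<Sum>y\<in>#B. y\<^sup>2)"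
proof (cases "B = {#}")
  case False
  define s where "s = \<Sum>\<^sub># B / real (size B)"
  have "0 \<le> (\<Sum>y\<in>#B. y\<^sup>2) - 2 * s * \<Sum>\<^sub># B + real (size B) * s\<^sup>2"
  proof (induction B)
    case (add x B)
    have "0 \<le> (x - s)\<^sup>2" by simp
    with add show ?case by (simp add: power2_eq_square algebra_simps)
  qed simp
  moreover have "0 < size B" using False by (simp add: nonempty_has_size)
  ultimately have "(\<Sum>\<^sub># B)\<^sup>2 \<le> real (size B) * (\<Sum>y\<in>#B. y\<^sup>2)"
    by (auto simp: s_def power2_eq_square field_simps split: if_splits)
  also have "\<dots> \<le> real N * (\<Sum>y\<in>#B. y\<^sup>2)"
  proof (rule mult_right_mono)
    show "0 \<le> (\<Sum>y\<in>#B. y\<^sup>2)" by (induction B) auto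
  qed (use assms in auto)
  finally show ?thesis .
qed simp

text \<open>Laguerre's inequality at the origin.  If \<open>q\<close> does not vanish at \<open>0\<close> it is a multiple of a product of
factors \<open>1 + y\<^sub>i t\<close> with \<open>y\<^sub>i\<close> real, and the claim is \<open>(\<Sum> y\<^sub>i)\<^sup>2 - \<Sum> y\<^sub>i\<^sup>2 \<le> (1 - 1/N) (\<Sum> y\<^sub>i)\<^sup>2\<close>, which is
Cauchy--Schwarz.\<close>

lemma laguerre_at_zero:
  fixes q :: "real poly"
  assumes rr: "real_rooted (map_poly complex_of_real q)" and deg: "degree q \<le> N" "0 < N"
  shows "2 * coeff q 0 * coeff q 2 \<le> (1 - 1 / real N) * (coeff q 1)\<^sup>2"
proof (cases "coeff q 0 = 0")
  case True
  then show ?thesis using deg by simp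
next
  case False
  let ?p = "map_poly complex_of_real q"
  have "q \<noteq> 0" using False by auto
  then have "?p \<noteq> 0" by (simp add: map_poly_eq_0_iff)
  then obtain A where A: "size A = degree ?p" "?p = smult (lead_coeff ?p) (\<Prod>x\<in>#A. [:-x, 1:])"
    using alg_closed_imp_factorization by blast
  define c where "c = lead_coeff ?p"
  have p: "?p = smult c (\<Prod>x\<in>#A. [:-x, 1:])" using A by (auto simp: c_def)
  have rts: "poly ?p x = 0" if "x \<in># A" for x
    using that p by (auto simp: poly_prod_mset prod_mset_zero_iff)
  have re: "Im x = 0" "x \<noteq> 0" if "x \<in># A" for x
  proof -
    show "Im x = 0" using rts[OF that] rr \<open>?p \<noteq> 0\<close> by (auto simp: real_rooted_def)
    show "x \<noteq> 0" using rts[OF that] False by (auto simp: poly_0_coeff_0 coeff_map_poly)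
  qed
  define B where "B = image_mset (\<lambda>x. - 1 / Re x) A"
  have "\<exists>d. (\<Prod>x\<in>#A. [:-x, 1:]) = smult d (map_poly complex_of_real (\<Prod>y\<in>#B. [:1, y:]))"
    using re unfolding B_def
  proof (induction A)
    case (add x A)
    then obtain d where d: "(\<Prod>x\<in>#A. [:-x, 1:]) =
        smult d (map_poly complex_of_real (\<Prod>y\<in>#image_mset (\<lambda>x. - 1 / Re x) A. [:1, y:]))"
      by auto
    have x: "x = complex_of_real (Re x)" "Re x \<noteq> 0"
      using add.prems[of x] by (auto simp: complex_eq_iff)
    have "[:-x, 1:] = smult (-x) (map_poly complex_of_real [:1, - 1 / Re x:])"
      using x by (auto simp: map_poly_pCons complex_eq_iff)
    then show ?case using d
      by (intro exI[of _ "-x * d"]) (simp del: mult_pCons_left add: of_real_poly_map_mult mult.commute)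
  qed (auto intro!: exI[of _ 1])
  then obtain d where "(\<Prod>x\<in>#A. [:-x, 1:]) = smult d (map_poly complex_of_real (\<Prod>y\<in>#B. [:1, y:]))"
    by blast
  then have "\<exists>e. ?p = smult e (map_poly complex_of_real (\<Prod>y\<in>#B. [:1, y:]))"
    using p by auto
  then obtain e where e: "?p = smult e (map_poly complex_of_real (\<Prod>y\<in>#B. [:1, y:]))" by blast
  have cf: "complex_of_real (coeff q i) = e * complex_of_real (coeff (\<Prod>y\<in>#B. [:1, y:]) i)" for i
    using arg_cong[OF e, of "\<lambda>p. coeff p i"] by (simp add: coeff_map_poly)
  have "e = complex_of_real (coeff q 0)" using cf[of 0] coeffs_prod_linear(1)[of B] by simp
  then have cf: "coeff q i = coeff q 0 * coeff (\<Prod>y\<in>#B. [:1, y:]) i" for i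
    using cf[of i] by (metis of_real_eq_iff of_real_mult)
  have "size B \<le> N" using A deg by (simp add: B_def degree_map_poly)
  then have S: "(\<Sum>\<^sub># B)\<^sup>2 / real N \<le> (\<Sum>y\<in>#B. y\<^sup>2)"
    using sum_mset_squares_ge deg by (simp add: field_simps)
  have "2 * coeff q 0 * coeff q 2 = (coeff q 0)\<^sup>2 * (2 * coeff (\<Prod>y\<in>#B. [:1, y:]) 2)"
    by (subst cf[of 2]) (simp add: power2_eq_square)
  also have "\<dots> = (coeff q 0)\<^sup>2 * ((\<Sum>\<^sub># B)\<^sup>2 - (\<Sum>y\<in>#B. y\<^sup>2))"
    unfolding coeffs_prod_linear(3) ..
  also have "\<dots> \<le> (coeff q 0)\<^sup>2 * ((\<Sum>\<^sub># B)\<^sup>2 - (\<Sum>\<^sub># B)\<^sup>2 / real N)"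
    using S by (intro mult_left_mono) auto
  also have "\<dots> = (1 - 1 / real N) * (coeff q 1)\<^sup>2"
    by (subst cf[of 1], subst coeffs_prod_linear(2)) (simp add: field_simps)
  finally show ?thesis .
qed

section \<open>Elementary symmetric functions on the cone\<close>

text \<open>Defining the symmetric functions as coefficients of \<open>\<Prod> (1 + l\<^sub>i t)\<close> makes both the recursion in \<open>S\<close> and
real-rootedness immediate.\<close>

definition esym :: "('i \<Rightarrow> real) \<Rightarrow> 'i set \<Rightarrow> nat \<Rightarrow> real" where
  "esym l S k = coeff (\<Prod>i\<in>S. [:1, l i:]) k"

lemma esym_0 [simp]: "esym l S 0 = 1"
  unfolding esym_def by (induction S rule: infinite_finite_induct) auto

lemma esym_empty: "esym l {} k = (if k = 0 then 1 else 0)"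
  by (simp add: esym_def)

lemma esym_insert:
  assumes "finite S" "j \<notin> S"
  shows "esym l (insert j S) (Suc k) = esym l S (Suc k) + l j * esym l S k"
  using assms by (simp add: esym_def)

lemma esym_remove:
  assumes "finite S" "j \<in> S"
  shows "esym l S (Suc k) = esym l (S - {j}) (Suc k) + l j * esym l (S - {j}) k"
  using esym_insert[of "S - {j}" j l k] assms by (simp add: insert_absorb)

lemma degree_esym: "degree (\<Prod>i\<in>S. [:1, l i:] :: real poly) \<le> card S"
proof (induction S rule: infinite_finite_induct)
  case (insert x F)
  have "degree ([:1, l x:] * (\<Prod>i\<in>F. [:1, l i:])) \<le> degree [:1, l x:] + degree (\<Prod>i\<in>F. [:1, l i:])"
    by (rule degree_mult_le)
  also have "\<dots> \<le> 1 + card F" using insert by (intro add_mono) (auto intro: order_trans)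
  finally show ?case using insert by simp
qed auto

lemma real_rooted_esym: "real_rooted (map_poly complex_of_real (\<Prod>i\<in>S. [:1, l i:]))"
proof -
  have "poly (map_poly complex_of_real (\<Prod>i\<in>S. [:1, l i:])) z = (\<Prod>i\<in>S. 1 + z * complex_of_real (l i))" for z
    by (induction S rule: infinite_finite_induct)
       (simp_all del: mult_pCons_left add: of_real_poly_map_mult map_poly_pCons)
  moreover have "Im z = 0" if "1 + z * complex_of_real (l i) = 0" for z i
    using that by (auto simp: complex_eq_iff)
  ultimately show ?thesis
    unfolding real_rooted_def by (cases "finite S") auto
qed

lemma map_poly_pderiv_of_real: "map_poly complex_of_real (pderiv q) = pderiv (map_poly complex_of_real q)"
  by (rule poly_eqI) (simp add: coeff_map_poly coeff_pderiv)

text \<open>The \<open>(k-1)\<close>-st derivative of \<open>\<Prod> (1 + l\<^sub>i t)\<close> is real-rooted, and its first three coefficients are, up to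
factorials, \<open>e\<^bsub>k-1\<^esub>\<close>, \<open>e\<^sub>k\<close> and \<open>e\<^bsub>k+1\<^esub>\<close>; so this is Laguerre's inequality for that derivative.  The \<open>l\<^sub>i\<close>
may have any sign.  The factor \<open>1 - 1/N < 1\<close> is what the bound for two removed variables depends on.\<close>

lemma newton_inequality:
  assumes "card S \<le> N" "0 < N" "1 \<le> k"
  shows "esym l S (k - 1) * esym l S (k + 1) \<le> (1 - 1 / real N) * (esym l S k)\<^sup>2"
proof -
  obtain k' where k: "k = Suc k'" using assms by (cases k) auto
  define p where "p = (\<Prod>i\<in>S. [:1, l i:] :: real poly)"
  define q where "q = (pderiv ^^ k') p"
  have "real_rooted (map_poly complex_of_real ((pderiv ^^ i) p))" for i
    by (induction i) (auto simp: p_def real_rooted_esym map_poly_pderiv_of_real intro: real_rooted_pderiv)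
  then have rr: "real_rooted (map_poly complex_of_real q)" by (simp add: q_def)
  have "degree q \<le> N"
    using degree_esym[of l S] assms unfolding q_def p_def by (simp add: degree_higher_pderiv)
  note L = laguerre_at_zero[OF rr this assms(2)]
  let ?a = "esym l S k'" and ?b = "esym l S (Suc k')" and ?c = "esym l S (Suc (Suc k'))"
  have c0: "coeff q 0 = fact k' * ?a"
    by (simp add: q_def coeff_higher_pderiv pochhammer_fact esym_def p_def)
  have c1: "coeff q 1 = fact k' * (real k' + 1) * ?b"
    using pochhammer_rec[of "1::real" k']
    by (simp add: q_def coeff_higher_pderiv esym_def p_def algebra_simps flip: pochhammer_fact)
  have c2: "2 * coeff q 2 = fact k' * (real k' + 1) * (real k' + 2) * ?c"
    using pochhammer_rec[of "2::real" k'] pochhammer_rec[of "1::real" "Suc k'"]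
    by (simp add: q_def coeff_higher_pderiv esym_def p_def algebra_simps flip: pochhammer_fact)
  have "(fact k')\<^sup>2 * (real k' + 1) * ((real k' + 2) * (?a * ?c)) = 2 * coeff q 0 * coeff q 2"
    using c0 c2 by (simp add: power2_eq_square)
  also have "\<dots> \<le> (fact k')\<^sup>2 * (real k' + 1) * ((1 - 1 / real N) * (real k' + 1) * ?b\<^sup>2)"
    using L c1 by (simp add: power2_eq_square mult_ac)
  finally have *: "(real k' + 2) * (?a * ?c) \<le> (1 - 1 / real N) * (real k' + 1) * ?b\<^sup>2"
    by (subst (asm) mult_le_cancel_left_pos) (auto simp: add_pos_nonneg)
  have nn: "0 \<le> (1 - 1 / real N) * ?b\<^sup>2" using assms by simp
  show ?thesis
  proof (cases "?a * ?c \<le> 0")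
    case True
    then show ?thesis using nn by (simp add: k)
  next
    case False
    have "(real k' + 2) * (?a * ?c) \<le> (real k' + 2) * ((1 - 1 / real N) * ?b\<^sup>2)"
    proof -
      have "(1 - 1 / real N) * (real k' + 1) * ?b\<^sup>2 \<le> (real k' + 2) * ((1 - 1 / real N) * ?b\<^sup>2)"
        using nn mult_right_mono[of "real k' + 1" "real k' + 2", OF _ nn] by (simp add: mult_ac)
      with * show "(real k' + 2) * (?a * ?c) \<le> (real k' + 2) * ((1 - 1 / real N) * ?b\<^sup>2)"
        by linarith
    qed
    then show ?thesis by (subst (asm) mult_le_cancel_left_pos) (auto simp: k)
  qed
qed

lemma sum_esym_remove:
  assumes "finite S"
  shows "(\<Sum>j\<in>S. esym l (S - {j}) k) = (real (card S) - real k) * esym l S k"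
  using assms
proof (induction S arbitrary: k)
  case empty
  then show ?case by (simp add: esym_empty)
next
  case (insert x S)
  show ?case
  proof (cases k)
    case 0
    then show ?thesis using insert by simp
  next
    case (Suc k')
    have "esym l (insert x S - {j}) k = esym l (S - {j}) k + l x * esym l (S - {j}) k'" if "j \<in> S" for j
      using that insert esym_insert[of "S - {j}" x l k'] by (auto simp: Suc insert_Diff_if)
    then have "(\<Sum>j\<in>insert x S. esym l (insert x S - {j}) k)
        = esym l S k + (\<Sum>j\<in>S. esym l (S - {j}) k + l x * esym l (S - {j}) k')"
      using insert by (simp add: Diff_insert_absorb)
    also have "\<dots> = esym l S k + (real (card S) - real k) * esym l S k
        + l x * ((real (card S) - real k') * esym l S k')"
      by (simp add: sum.distrib insert.IH flip: sum_distrib_left)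
    also have "\<dots> = (real (card (insert x S)) - real k) * esym l (insert x S) k"
      using insert esym_insert[of S x l k'] by (simp add: Suc algebra_simps)
    finally show ?thesis .
  qed
qed

text \<open>Euler's identity for the homogeneous polynomial \<open>e\<^bsub>k+1\<^esub>\<close>, as \<open>e\<^sub>k(S - {j})\<close> is its partial derivative in \<open>l\<^sub>j\<close>.\<close>

lemma esym_euler:
  assumes "finite S"
  shows "(\<Sum>j\<in>S. l j * esym l (S - {j}) k) = real (Suc k) * esym l S (Suc k)"
proof -
  have "real (card S) * esym l S (Suc k) = (\<Sum>j\<in>S. esym l (S - {j}) (Suc k) + l j * esym l (S - {j}) k)"
    unfolding sum_constant[symmetric] by (intro sum.cong refl esym_remove assms)
  also have "\<dots> = (real (card S) - real (Suc k)) * esym l S (Suc k) + (\<Sum>j\<in>S. l j * esym l (S - {j}) k)"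
    by (simp add: sum.distrib sum_esym_remove[OF assms])
  finally show ?thesis by (simp add: algebra_simps)
qed

text \<open>Removing a variable maps the cone of order \<open>m\<close> into the cone of order \<open>m - 1\<close>.  Write \<open>a\<^sub>k\<close> for the
symmetric functions of the remaining variables.  If \<open>a\<^bsub>k+1\<^esub> \<le> 0 < a\<^sub>k\<close>, positivity of
\<open>a\<^bsub>k+1\<^esub> + l\<^sub>j a\<^sub>k\<close> and of \<open>a\<^bsub>k+2\<^esub> + l\<^sub>j a\<^bsub>k+1\<^esub>\<close> forces \<open>a\<^sub>k a\<^bsub>k+2\<^esub> > a\<^bsub>k+1\<^esub>\<^sup>2\<close>, against Newton.\<close>

lemma esym_remove_pos:
  assumes "finite S" "j \<in> S" and pos: "\<And>k. k \<le> m \<Longrightarrow> 0 < esym l S k" and "k < m"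
  shows "0 < esym l (S - {j}) k"
  using \<open>k < m\<close>
proof (induction k)
  case (Suc k)
  let ?a = "esym l (S - {j})"
  have a: "0 < ?a k" using Suc by simp
  show ?case
  proof (rule ccontr)
    assume neg: "\<not> 0 < ?a (Suc k)"
    have "0 < ?a (Suc k) + l j * ?a k" "0 < ?a (Suc (Suc k)) + l j * ?a (Suc k)"
      using pos[of "Suc k"] pos[of "Suc (Suc k)"] Suc.prems esym_remove[OF assms(1,2)] by auto
    then have 1: "- ?a (Suc k) \<le> l j * ?a k" and 2: "- (l j * ?a (Suc k)) < ?a (Suc (Suc k))" by auto
    have "(?a (Suc k))\<^sup>2 \<le> (l j * ?a k) * - ?a (Suc k)"
      using mult_right_mono[OF 1, of "- ?a (Suc k)"] neg by (simp add: power2_eq_square)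
    also have "\<dots> = ?a k * - (l j * ?a (Suc k))" by simp
    also have "\<dots> < ?a k * ?a (Suc (Suc k))" using 2 a by (intro mult_strict_left_mono)
    also have "\<dots> \<le> (1 - 1 / real (card S)) * (?a (Suc k))\<^sup>2"
      using newton_inequality[of "S - {j}" "card S" "Suc k" l] assms(1,2)
      by (auto simp: card_gt_0_iff card_Diff_singleton)
    also have "\<dots> \<le> 1 * (?a (Suc k))\<^sup>2" by (intro mult_right_mono) auto
    finally show False by simp
  qed
qed simp

text \<open>The sum over all \<open>j\<close> is \<open>(card S - m) e\<^sub>m(S)\<close>, and its summands are positive.\<close>

lemma esym_remove_le:
  assumes "finite S" "j \<in> S" and pos: "\<And>k. k \<le> Suc m \<Longrightarrow> 0 < esym l S k"
  shows "esym l (S - {j}) m \<le> real (card S) * esym l S m"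
proof -
  have "esym l (S - {j}) m \<le> (\<Sum>j\<in>S. esym l (S - {j}) m)"
    using assms esym_remove_pos[OF assms(1) _ pos]
    by (intro member_le_sum) (auto intro: less_imp_le)
  also have "\<dots> \<le> real (card S) * esym l S m"
    unfolding sum_esym_remove[OF assms(1)] using pos[of m] by (intro mult_right_mono) auto
  finally show ?thesis .
qed

text \<open>The algebraic core of the theorem.  The proof multiplies the two functions with one variable removed and
uses \<open>(b + l\<^sub>k a) (b + l\<^sub>j a) = a e\<^bsub>m+1\<^esub> + (b\<^sup>2 - a c)\<close>.\<close>

lemma esym_remove_two_bound:
  assumes "finite S" "j \<in> S" "k \<in> S" "j \<noteq> k" and pos: "\<And>i. i \<le> Suc m \<Longrightarrow> 0 < esym l S i"
  shows "(esym l (S - {j, k}) m)\<^sup>2 \<le> (real (card S))\<^sup>2 * (esym l (S - {j}) m * esym l S m)"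
proof -
  have N: "0 < card S" using assms by (auto simp: card_gt_0_iff)
  have j: "0 < esym l (S - {j}) m" by (rule esym_remove_pos[OF assms(1,2) pos]) auto
  have k: "0 < esym l (S - {k}) m" by (rule esym_remove_pos[OF assms(1,3) pos]) auto
  show ?thesis
  proof (cases m)
    case 0
    then show ?thesis using N by simp
  next
    case (Suc m')
    let ?T = "S - {j, k}"
    define a b c where "a = esym l ?T m'" and "b = esym l ?T m" and "c = esym l ?T (Suc m)"
    have sets: "S - {j} - {k} = ?T" "S - {k} - {j} = ?T" by auto
    have Sj: "esym l (S - {j}) m = b + l k * a" "esym l (S - {j}) (Suc m) = c + l k * b"
      using esym_remove[of "S - {j}" k l] assms by (auto simp: Suc sets a_def b_def c_def)
    have Sk: "esym l (S - {k}) m = b + l j * a"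
      using esym_remove[of "S - {k}" j l] assms by (auto simp: Suc sets a_def b_def c_def)
    have E: "esym l S (Suc m) = c + l k * b + l j * (b + l k * a)"
      using esym_remove[of S j l m] assms Sj by simp
    have "0 < esym l (S - {j} - {k}) m'"
      by (rule esym_remove_pos[of _ _ m]) (use assms Suc in \<open>auto intro!: esym_remove_pos[OF assms(1,2) pos]\<close>)
    then have "0 < a" by (simp add: a_def sets)
    have newton: "a * c \<le> (1 - 1 / real (card S)) * b\<^sup>2"
      using newton_inequality[of ?T "card S" m l] assms N
      by (auto simp: Suc a_def b_def c_def intro: card_mono)
    have "b\<^sup>2 / real (card S) \<le> b\<^sup>2 - a * c" using newton by (simp add: algebra_simps)
    also have "\<dots> \<le> a * esym l S (Suc m) + (b\<^sup>2 - a * c)"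
      using \<open>0 < a\<close> pos[of "Suc m"] by simp
    also have "\<dots> = esym l (S - {j}) m * esym l (S - {k}) m"
      unfolding E Sj Sk by (simp add: algebra_simps power2_eq_square)
    also have "\<dots> \<le> esym l (S - {j}) m * (real (card S) * esym l S m)"
      using j by (intro mult_left_mono esym_remove_le assms) auto
    finally show ?thesis using N by (simp add: b_def field_simps power2_eq_square)
  qed
qed

section \<open>The exterior algebra as a ring\<close>

text \<open>The wedge product is associative, bilinear and unital, so a copy of the exterior algebra is an instance of
the class of rings; sums, products and powers of forms at a point are then those of the library.\<close>

typedef 'n alt = "UNIV :: 'n ext set" morphisms coeffs Alt ..

lemma alt_eqI: "(\<And>I J. coeffs a I J = coeffs b I J) \<Longrightarrow> a = b"
  by (metis coeffs_inverse ext)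

text \<open>The sign in \<open>(dz\<^sub>A \<and> dz*\<^sub>B) \<and> (dz\<^sub>C \<and> dz*\<^sub>D) = \<plusminus> dz\<^bsub>A \<union> C\<^esub> \<and> dz*\<^bsub>B \<union> D\<^esub>\<close>.\<close>

definition wedge_sign :: "'n::linorder set \<Rightarrow> 'n set \<Rightarrow> 'n set \<Rightarrow> 'n set \<Rightarrow> complex" where
  "wedge_sign A B C D = (- 1) ^ (card B * card C) * shuffle_sign A C * shuffle_sign B D"

lemma ext_wedge_alt_def:
  "ext_wedge a b I J = (\<Sum>A\<in>Pow I. \<Sum>B\<in>Pow J.
     wedge_sign A B (I - A) (J - B) * a A B * b (I - A) (J - B))"
  by (simp add: ext_wedge_def wedge_sign_def)

lemma shuffle_sign_empty [simp]: "shuffle_sign {} K = 1" "shuffle_sign I {} = 1"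
  by (simp_all add: shuffle_sign_def)

lemma shuffle_sign_Un:
  fixes A B C :: "'n::{finite,linorder} set"
  assumes "A \<inter> B = {}"
  shows "shuffle_sign (A \<union> B) C = shuffle_sign A C * shuffle_sign B C"
    and "shuffle_sign C (A \<union> B) = shuffle_sign C A * shuffle_sign C B"
proof -
  have "{(i, k). i \<in> A \<union> B \<and> k \<in> C \<and> k < i} = {(i, k). i \<in> A \<and> k \<in> C \<and> k < i} \<union> {(i, k). i \<in> B \<and> k \<in> C \<and> k < i}"
    by auto
  moreover have "card \<dots> = card {(i, k). i \<in> A \<and> k \<in> C \<and> k < i} + card {(i, k). i \<in> B \<and> k \<in> C \<and> k < i}"
    using assms by (intro card_Un_disjoint) auto
  ultimately show "shuffle_sign (A \<union> B) C = shuffle_sign A C * shuffle_sign B C"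
    by (simp add: shuffle_sign_def power_add)
  have "{(i, k). i \<in> C \<and> k \<in> A \<union> B \<and> k < i} = {(i, k). i \<in> C \<and> k \<in> A \<and> k < i} \<union> {(i, k). i \<in> C \<and> k \<in> B \<and> k < i}"
    by auto
  moreover have "card \<dots> = card {(i, k). i \<in> C \<and> k \<in> A \<and> k < i} + card {(i, k). i \<in> C \<and> k \<in> B \<and> k < i}"
    using assms by (intro card_Un_disjoint) auto
  ultimately show "shuffle_sign C (A \<union> B) = shuffle_sign C A * shuffle_sign C B"
    by (simp add: shuffle_sign_def power_add)
qed

text \<open>This cocycle identity is associativity on basis elements; the general case follows by summing over ordered
partitions of the index sets into three parts.\<close>

lemma wedge_sign_assoc:
  fixes A B C D E F :: "'n::{finite,linorder} set"
  assumes "A \<inter> C = {}" "C \<inter> E = {}" "B \<inter> D = {}" "D \<inter> F = {}"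
  shows "wedge_sign (A \<union> C) (B \<union> D) E F * wedge_sign A B C D
       = wedge_sign A B (C \<union> E) (D \<union> F) * wedge_sign C D E F"
proof -
  have "card (B \<union> D) = card B + card D" "card (C \<union> E) = card C + card E"
    using assms by (auto intro: card_Un_disjoint)
  then show ?thesis
    using assms by (simp add: wedge_sign_def shuffle_sign_Un power_add algebra_simps)
qed

text \<open>Both sides run over the ordered partitions of \<open>I\<close> into three parts.\<close>

lemma sum_Pow_Pow:
  fixes f :: "'n::finite set \<Rightarrow> 'n set \<Rightarrow> 'n set \<Rightarrow> 'a::comm_monoid_add"
  shows "(\<Sum>A\<in>Pow I. \<Sum>B\<in>Pow A. f B (A - B) (I - A)) = (\<Sum>B\<in>Pow I. \<Sum>C\<in>Pow (I - B). f B C (I - B - C))"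
proof -
  have "(\<Sum>A\<in>Pow I. \<Sum>B\<in>Pow A. f B (A - B) (I - A)) = (\<Sum>(A, B)\<in>Sigma (Pow I) Pow. f B (A - B) (I - A))"
    by (intro sum.Sigma) auto
  also have "\<dots> = (\<Sum>(B, C)\<in>Sigma (Pow I) (\<lambda>B. Pow (I - B)). f B C (I - B - C))"
    by (rule sum.reindex_bij_witness[of _ "\<lambda>(B, C). (B \<union> C, B)" "\<lambda>(A, B). (B, A - B)"])
       (auto intro!: arg_cong2[of _ _ _ _ "f _"])
  also have "\<dots> = (\<Sum>B\<in>Pow I. \<Sum>C\<in>Pow (I - B). f B C (I - B - C))"
    by (intro sum.Sigma[symmetric]) auto
  finally show ?thesis .
qed

lemma ext_wedge_assoc: "ext_wedge (ext_wedge a b) c = ext_wedge a (ext_wedge b c)"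
proof (intro ext)
  fix I J :: "'a set"
  define F where "F A C E B D G = wedge_sign (A \<union> C) (B \<union> D) E G * wedge_sign A B C D * a A B * b C D * c E G"
    for A C E B D G
  have "ext_wedge (ext_wedge a b) c I J
      = (\<Sum>A'\<in>Pow I. \<Sum>B'\<in>Pow J. \<Sum>A\<in>Pow A'. \<Sum>B\<in>Pow B'. F A (A' - A) (I - A') B (B' - B) (J - B'))"
    unfolding ext_wedge_alt_def sum_distrib_left sum_distrib_right F_def
    by (intro sum.cong refl) (auto simp: Un_absorb1 Un_absorb2 mult_ac Un_Diff_cancel)
  also have "\<dots> = (\<Sum>A'\<in>Pow I. \<Sum>A\<in>Pow A'. \<Sum>B'\<in>Pow J. \<Sum>B\<in>Pow B'. F A (A' - A) (I - A') B (B' - B) (J - B'))"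
    by (intro sum.cong refl sum.swap)
  also have "\<dots> = (\<Sum>A'\<in>Pow I. \<Sum>A\<in>Pow A'. \<Sum>B\<in>Pow J. \<Sum>D\<in>Pow (J - B). F A (A' - A) (I - A') B D (J - B - D))"
    by (subst sum_Pow_Pow) simp
  also have "\<dots> = (\<Sum>A\<in>Pow I. \<Sum>C\<in>Pow (I - A). \<Sum>B\<in>Pow J. \<Sum>D\<in>Pow (J - B). F A C (I - A - C) B D (J - B - D))"
    by (rule sum_Pow_Pow)
  also have "\<dots> = (\<Sum>A\<in>Pow I. \<Sum>B\<in>Pow J. \<Sum>C\<in>Pow (I - A). \<Sum>D\<in>Pow (J - B). F A C (I - A - C) B D (J - B - D))"
    by (intro sum.cong refl sum.swap)
  also have "\<dots> = ext_wedge a (ext_wedge b c) I J"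
    unfolding ext_wedge_alt_def sum_distrib_left
  proof (intro sum.cong refl)
    fix A B C D assume *: "A \<in> Pow I" "B \<in> Pow J" "C \<in> Pow (I - A)" "D \<in> Pow (J - B)"
    have "wedge_sign (A \<union> C) (B \<union> D) (I - A - C) (J - B - D) * wedge_sign A B C D
       = wedge_sign A B (C \<union> (I - A - C)) (D \<union> (J - B - D)) * wedge_sign C D (I - A - C) (J - B - D)"
      by (rule wedge_sign_assoc) (use * in auto)
    moreover have "C \<union> (I - A - C) = I - A" "D \<union> (J - B - D) = J - B" using * by auto
    ultimately show "F A C (I - A - C) B D (J - B - D) = wedge_sign A B (I - A) (J - B) * a A B *
       (wedge_sign C D (I - A - C) (J - B - D) * b C D * c (I - A - C) (J - B - D))"
      by (simp add: F_def)
  qed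
  finally show "ext_wedge (ext_wedge a b) c I J = ext_wedge a (ext_wedge b c) I J" .
qed

definition ext_basis :: "'n set \<Rightarrow> 'n set \<Rightarrow> 'n ext" where
  "ext_basis A B = (\<lambda>I J. if I = A \<and> J = B then 1 else 0)"

lemma ext_wedge_basis_left:
  "ext_wedge (ext_basis A B) b I J
     = (if A \<subseteq> I \<and> B \<subseteq> J then wedge_sign A B (I - A) (J - B) * b (I - A) (J - B) else 0)"
proof -
  have "ext_wedge (ext_basis A B) b I J = (\<Sum>A'\<in>Pow I. \<Sum>B'\<in>Pow J.
     if B' = B then (if A' = A then wedge_sign A B (I - A) (J - B) * b (I - A) (J - B) else 0) else 0)"
    unfolding ext_wedge_alt_def by (intro sum.cong refl) (auto simp: ext_basis_def)
  also have "\<dots> = (\<Sum>A'\<in>Pow I. if A' = A then (if B \<in> Pow J then wedge_sign A B (I - A) (J - B) * b (I - A) (J - B) else 0) else 0)"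
    by (subst sum.delta) (auto intro!: sum.cong)
  also have "\<dots> = (if A \<subseteq> I \<and> B \<subseteq> J then wedge_sign A B (I - A) (J - B) * b (I - A) (J - B) else 0)"
    by (subst sum.delta) auto
  finally show ?thesis .
qed

lemma ext_wedge_basis:
  "ext_wedge (ext_basis A B) (ext_basis C D) =
     (\<lambda>I J. if A \<inter> C = {} \<and> B \<inter> D = {} then wedge_sign A B C D * ext_basis (A \<union> C) (B \<union> D) I J else 0)"
proof (intro ext)
  fix I J
  have *: "(A \<subseteq> I \<and> I - A = C) \<longleftrightarrow> (A \<inter> C = {} \<and> I = A \<union> C)" "(B \<subseteq> J \<and> J - B = D) \<longleftrightarrow> (B \<inter> D = {} \<and> J = B \<union> D)"
    by auto
  show "ext_wedge (ext_basis A B) (ext_basis C D) I J =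
     (if A \<inter> C = {} \<and> B \<inter> D = {} then wedge_sign A B C D * ext_basis (A \<union> C) (B \<union> D) I J else 0)"
    unfolding ext_wedge_basis_left using * by (auto simp: ext_basis_def)
qed

lemma ext_wedge_one: "ext_wedge ext_one b = b" "ext_wedge b ext_one = b"
proof -
  have one: "ext_one = ext_basis {} {}" by (auto simp: ext_one_def ext_basis_def)
  show "ext_wedge ext_one b = b"
    unfolding one by (intro ext) (simp add: ext_wedge_basis_left wedge_sign_def)
  show "ext_wedge b ext_one = b"
  proof (intro ext)
    fix I J
    have "ext_wedge b ext_one I J = (\<Sum>A\<in>Pow I. \<Sum>B\<in>Pow J. if B = J then (if A = I then b I J else 0) else 0)"
      unfolding ext_wedge_alt_def
      by (intro sum.cong refl) (auto simp: ext_one_def wedge_sign_def)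
    then show "ext_wedge b ext_one I J = b I J" by (simp add: sum.delta)
  qed
qed

instantiation alt :: ("{finite,linorder}") ring_1
begin

definition "0 = Alt (\<lambda>I J. 0)"
definition "1 = Alt ext_one"
definition "a + b = Alt (\<lambda>I J. coeffs a I J + coeffs b I J)"
definition "a - b = Alt (\<lambda>I J. coeffs a I J - coeffs b I J)"
definition "- a = Alt (\<lambda>I J. - coeffs a I J)"
definition "a * b = Alt (ext_wedge (coeffs a) (coeffs b))"

lemma coeffs_simps:
  "coeffs (0 :: 'a alt) I J = 0"
  "coeffs (1 :: 'a alt) = ext_one"
  "coeffs (a + b) I J = coeffs a I J + coeffs b I J"
  "coeffs (a - b) I J = coeffs a I J - coeffs b I J"
  "coeffs (- a) I J = - coeffs a I J"
  "coeffs (a * b) = ext_wedge (coeffs a) (coeffs b)" for a b :: "'a alt"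
  by (simp_all add: zero_alt_def one_alt_def plus_alt_def minus_alt_def uminus_alt_def times_alt_def Alt_inverse)

instance
proof
  fix a b c :: "'a alt"
  show "a * b * c = a * (b * c)" by (intro alt_eqI) (simp add: coeffs_simps ext_wedge_assoc)
  show "1 * a = a" "a * 1 = a" by (intro alt_eqI; simp add: coeffs_simps ext_wedge_one)+
  show "(a + b) * c = a * c + b * c" "a * (b + c) = a * b + a * c"
    by (intro alt_eqI; simp add: coeffs_simps ext_wedge_def algebra_simps sum.distrib)+
  show "(0 :: 'a alt) \<noteq> 1"
  proof
    assume "(0 :: 'a alt) = 1"
    then have "coeffs (0 :: 'a alt) {} {} = coeffs 1 {} {}" by simp
    then show False by (simp add: coeffs_simps ext_one_def)
  qed
qed (intro alt_eqI; simp add: coeffs_simps)+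

end

definition smul :: "complex \<Rightarrow> 'n alt \<Rightarrow> 'n alt" (infixr "*\<^sub>c" 75) where
  "c *\<^sub>c a = Alt (\<lambda>I J. c * coeffs a I J)"

lemma coeffs_smul: "coeffs (c *\<^sub>c a) I J = c * coeffs a I J"
  by (simp add: smul_def Alt_inverse)

lemma coeffs_sum: "coeffs (\<Sum>i\<in>S. f i) I J = (\<Sum>i\<in>S. coeffs (f i) I J)"
  by (induction S rule: infinite_finite_induct) (simp_all add: coeffs_simps)

lemma smul_mult [simp]:
  fixes a b :: "'n::{finite,linorder} alt"
  shows "(c *\<^sub>c a) * b = c *\<^sub>c (a * b)" "a * (c *\<^sub>c b) = c *\<^sub>c (a * b)"
  by (intro alt_eqI; simp add: coeffs_smul coeffs_simps ext_wedge_def sum_distrib_left mult_ac)+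

lemma smul_simps [simp]:
  fixes a :: "'n::{finite,linorder} alt"
  shows "c *\<^sub>c (d *\<^sub>c a) = (c * d) *\<^sub>c a" "1 *\<^sub>c a = a" "0 *\<^sub>c a = 0" "c *\<^sub>c (0 :: 'n alt) = 0"
  by (intro alt_eqI; simp add: coeffs_smul coeffs_simps)+

lemma smul_distribs:
  fixes a b :: "'n::{finite,linorder} alt"
  shows "c *\<^sub>c (a + b) = c *\<^sub>c a + c *\<^sub>c b" "(c + d) *\<^sub>c a = c *\<^sub>c a + d *\<^sub>c a"
    "c *\<^sub>c (a - b) = c *\<^sub>c a - c *\<^sub>c b" "(c - d) *\<^sub>c a = c *\<^sub>c a - d *\<^sub>c a"
    "c *\<^sub>c (- a) = (- c) *\<^sub>c a" "- (c *\<^sub>c a) = (- c) *\<^sub>c a"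
  by (intro alt_eqI; simp add: coeffs_smul coeffs_simps algebra_simps)+

lemma smul_minus_one [simp]: "(- 1) *\<^sub>c a = - a" for a :: "'n::{finite,linorder} alt"
  by (intro alt_eqI) (simp add: coeffs_smul coeffs_simps)

lemma smul_sum:
  fixes f :: "'i \<Rightarrow> 'n::{finite,linorder} alt"
  shows "c *\<^sub>c (\<Sum>i\<in>S. f i) = (\<Sum>i\<in>S. c *\<^sub>c f i)" "(\<Sum>i\<in>S. g i) *\<^sub>c a = (\<Sum>i\<in>S. g i *\<^sub>c a)"
  by (intro alt_eqI; simp add: coeffs_smul coeffs_sum sum_distrib_left sum_distrib_right)+

lemma eq_uminus_alt: "a = - a \<Longrightarrow> a = 0" for a :: "'n::{finite,linorder} alt"
proof (rule alt_eqI)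
  fix I J assume "a = - a"
  then have "coeffs a I J = coeffs (- a) I J" by simp
  then show "coeffs a I J = coeffs 0 I J" by (simp add: coeffs_simps)
qed

definition dens :: "'n::finite alt \<Rightarrow> complex" where
  "dens a = ext_density (coeffs a)"

lemma dens_simps [simp]:
  fixes a b :: "'n::{finite,linorder} alt"
  shows "dens (0 :: 'n alt) = 0" "dens (a + b) = dens a + dens b" "dens (a - b) = dens a - dens b"
    "dens (- a) = - dens a" "dens (c *\<^sub>c a) = c * dens a" "dens (\<Sum>i\<in>S. f i :: 'n alt) = (\<Sum>i\<in>S. dens (f i))"
  by (simp_all add: dens_def ext_density_def coeffs_simps coeffs_smul coeffs_sum diff_divide_distrib
      add_divide_distrib sum_divide_distrib)

text \<open>The Boolean index treats \<open>dz\<^sub>j\<close> (true) and its conjugate (false) uniformly, since both kinds anticommute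
by the same rule.\<close>

definition gen :: "bool \<Rightarrow> 'n \<Rightarrow> 'n alt" where
  "gen s j = (if s then Alt (ext_dz j) else Alt (ext_dzbar j))"

lemma coeffs_gen: "coeffs (gen s j) = (if s then ext_basis {j} {} else ext_basis {} {j})"
  by (auto simp: gen_def Alt_inverse ext_dz_def ext_dzbar_def ext_basis_def)

lemma gen_anticommute: "gen s i * gen t j = - (gen t j * gen s i)"
  for i j :: "'n::{finite,linorder}"
proof -
  have sh: "shuffle_sign {i} {j} = - shuffle_sign {j} {i}" if "i \<noteq> j" for i j :: 'n
  proof -
    have "{(a, k). a = i \<and> k = j \<and> k < a} = (if j < i then {(i, j)} else {})"
      "{(a, k). a = j \<and> k = i \<and> k < a} = (if i < j then {(j, i)} else {})" by auto
    then show ?thesis using that by (auto simp: shuffle_sign_def)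
  qed
  have "coeffs (gen s i * gen t j) I J = coeffs (- (gen t j * gen s i)) I J" for I J
    using sh[of i j]
    by (cases s; cases t; cases "i = j")
       (auto simp: coeffs_simps coeffs_gen ext_wedge_basis wedge_sign_def insert_commute)
  then show ?thesis by (rule alt_eqI)
qed

section \<open>Powers of diagonal forms in a coframe\<close>

lemma card_Compl_finite: "card (- A) = CARD('n) - card A" for A :: "'n::finite set"
  by (simp add: Compl_eq_Diff_UNIV card_Diff_subset)

text \<open>The powers of diagonal forms can be evaluated from the anticommutation rule alone; the Boolean index has
the same meaning as for \<open>gen\<close>.\<close>

locale coframe =
  fixes \<theta> :: "bool \<Rightarrow> 'n \<Rightarrow> 'n::{finite,linorder} alt"
  assumes anti: "\<theta> s p * \<theta> t q = - (\<theta> t q * \<theta> s p)"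
begin

lemma square [simp]: "\<theta> s p * \<theta> s p = 0"
  by (rule eq_uminus_alt) (rule anti)

lemma square' [simp]: "\<theta> s p * (\<theta> s p * y) = 0"
  by (simp flip: mult.assoc)

lemma anti': "\<theta> s p * (\<theta> t q * y) = - (\<theta> t q * (\<theta> s p * y))"
  unfolding mult.assoc[symmetric] anti[of s p t q] by simp

text \<open>The \<open>(1,1)\<close>-form of the complex line dual to \<open>\<theta>\<^sub>p\<close>.  These elements commute with each other and with
every \<open>\<theta>\<close>, and have square zero.\<close>

definition area :: "'n \<Rightarrow> 'n alt" where
  "area p = \<i> *\<^sub>c (\<theta> True p * \<theta> False p)"

lemma theta_pair: "\<theta> s p * \<theta> (\<not> s) p = (if s then - \<i> else \<i>) *\<^sub>c area p"
  using anti[of False p True p] by (cases s) (simp_all add: area_def smul_distribs)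

lemma area_theta: "area p * \<theta> s q = \<theta> s q * area p"
  by (simp add: area_def mult.assoc anti[of False p s q] anti'[of True p s q])

lemma area_theta': "area p * (\<theta> s q * y) = \<theta> s q * (area p * y)"
  by (simp add: area_theta flip: mult.assoc)

lemma area_theta_0 [simp]: "area p * \<theta> s p = 0" "area p * (\<theta> s p * y) = 0"
proof -
  show "area p * \<theta> s p = 0"
    by (cases s) (simp_all add: area_def mult.assoc anti[of False p True p] smul_distribs)
  then show "area p * (\<theta> s p * y) = 0" by (simp flip: mult.assoc)
qed

lemma area_commute: "area p * area q = area q * area p"
  unfolding area_def[of q] by (simp add: area_theta area_theta' mult.assoc)

lemma area_commute': "area p * (area q * y) = area q * (area p * y)"
  unfolding mult.assoc[symmetric] area_commute[of p q] ..

lemma area_square [simp]: "area p * area p = 0" "area p * (area p * y) = 0"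
proof -
  show "area p * area p = 0" by (subst (2) area_def) simp
  then show "area p * (area p * y) = 0" by (simp flip: mult.assoc)
qed

text \<open>The product of the commuting elements \<open>area p\<close> over \<open>p \<in> S\<close>; the ring is not commutative, so it is
written as a fold.\<close>

definition vol :: "'n set \<Rightarrow> 'n alt" where
  "vol S = Finite_Set.fold (\<lambda>p y. area p * y) 1 S"

lemma vol_empty [simp]: "vol {} = 1"
  by (simp add: vol_def)

lemma vol_insert: "p \<notin> S \<Longrightarrow> vol (insert p S) = area p * vol S"
proof -
  interpret comp_fun_commute "\<lambda>p y. area p * y"
    by standard (auto simp: area_commute')
  show "p \<notin> S \<Longrightarrow> vol (insert p S) = area p * vol S"
    unfolding vol_def by (rule fold_insert) auto
qed

lemma vol_remove: "p \<in> S \<Longrightarrow> vol S = area p * vol (S - {p})"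
  using vol_insert[of p "S - {p}"] by (simp add: insert_absorb)

lemma area_vol: "area p * vol S = vol S * area p"
proof -
  have "finite S" by simp
  then show ?thesis
    by (induction S) (simp_all add: vol_insert area_commute' mult.assoc)
qed

definition diag :: "('n \<Rightarrow> real) \<Rightarrow> 'n alt" where
  "diag l = (\<Sum>p\<in>UNIV. complex_of_real (l p) *\<^sub>c area p)"

lemma diag_theta: "diag l * \<theta> s q = \<theta> s q * diag l"
  by (simp add: diag_def sum_distrib_left sum_distrib_right area_theta)

lemma diag_area: "diag l * area q = area q * diag l"
  by (simp add: diag_def sum_distrib_left sum_distrib_right area_commute)

lemma diag_commute: "diag l * diag l' = diag l' * diag l"
  by (simp add: diag_def[of l'] sum_distrib_left sum_distrib_right diag_area)

text \<open>With \<open>l\<close> the eigenvalues of \<open>\<gamma>\<close> with respect to \<open>\<omega>\<close> this is \<open>\<gamma>\<^sup>a \<and> \<omega>\<^sup>b\<close>.\<close>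

definition mixed :: "('n \<Rightarrow> real) \<Rightarrow> nat \<Rightarrow> nat \<Rightarrow> 'n alt" where
  "mixed l a b = diag l ^ a * diag (\<lambda>_. 1) ^ b"

lemma mixed_theta: "mixed l a b * \<theta> s q = \<theta> s q * mixed l a b"
proof -
  have pow: "diag l ^ k * \<theta> s q = \<theta> s q * diag l ^ k" for l k
    by (intro power_commuting_commutes diag_theta)
  have "mixed l a b * \<theta> s q = diag l ^ a * \<theta> s q * diag (\<lambda>_. 1) ^ b"
    unfolding mixed_def mult.assoc pow[of "\<lambda>_. 1"] ..
  then show ?thesis by (simp add: pow mixed_def flip: mult.assoc)
qed

lemma mixed_theta': "mixed l a b * (\<theta> s q * y) = \<theta> s q * (mixed l a b * y)"
  by (simp add: mixed_theta flip: mult.assoc)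

lemma mixed_Suc_left: "mixed l (Suc a) b * y = mixed l a b * (diag l * y)"
proof -
  have "diag (\<lambda>_. 1) ^ b * diag l = diag l * diag (\<lambda>_. 1) ^ b"
    by (intro power_commuting_commutes diag_commute)
  then have "mixed l a b * diag l = diag l ^ a * diag l * diag (\<lambda>_. 1) ^ b"
    by (simp add: mixed_def mult.assoc)
  also have "\<dots> = mixed l (Suc a) b" by (simp add: mixed_def power_commutes)
  finally show ?thesis by (simp flip: mult.assoc)
qed

lemma mixed_Suc_right: "mixed l a (Suc b) * y = mixed l a b * (diag (\<lambda>_. 1) * y)"
  by (simp add: mixed_def power_Suc2 mult.assoc del: power_Suc)

lemma mixed_0_0 [simp]: "mixed l 0 0 = 1"
  by (simp add: mixed_def)

lemma diag_mult:
  assumes "\<And>p. p \<notin> S \<Longrightarrow> area p * y = 0"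
  shows "diag l * y = (\<Sum>p\<in>S. complex_of_real (l p) *\<^sub>c (area p * y))"
proof -
  have "diag l * y = (\<Sum>p\<in>UNIV. complex_of_real (l p) *\<^sub>c (area p * y))"
    by (simp add: diag_def sum_distrib_right)
  also have "\<dots> = (\<Sum>p\<in>S. complex_of_real (l p) *\<^sub>c (area p * y))"
    using assms by (intro sum.mono_neutral_right) auto
  finally show ?thesis .
qed

text \<open>Each of the \<open>a + b\<close> factors contributes some \<open>area p\<close> with \<open>p \<in> S\<close>, and no \<open>p\<close> can be used twice.\<close>

lemma mixed_eq_0:
  assumes "\<And>p. p \<notin> S \<Longrightarrow> area p * y = 0" and "card S < a + b"
  shows "mixed l a b * y = 0"
  using assms
proof (induction "a + b" arbitrary: a b S y)
  case (Suc N)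
  have IH: "mixed l a' b' * (area p * y) = 0" if "a' + b' = N" "p \<in> S" for a' b' p
  proof (rule Suc.hyps(1)[of a' b' "S - {p}"])
    show "area q * (area p * y) = 0" if "q \<notin> S - {p}" for q
      using that Suc.prems(1)[of q] by (cases "q = p") (auto simp: area_commute'[of q p])
    have "card (S - {p}) < card S" using that by (intro psubset_card_mono) auto
    then show "card (S - {p}) < a' + b'" using that Suc by simp
  qed (use that in auto)
  show ?case
  proof (cases a)
    case (Suc a')
    then show ?thesis using IH[of a' b] Suc.hyps(2)
      by (simp only: mixed_Suc_left diag_mult[OF Suc.prems(1)] sum_distrib_left) (auto simp del: power_Suc)
  next
    case 0
    then obtain b' where "b = Suc b'" using Suc.hyps(2) by (cases b) auto
    then show ?thesis using IH[of a b'] Suc.hyps(2)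
      by (simp only: mixed_Suc_right diag_mult[OF Suc.prems(1)] sum_distrib_left) (auto simp del: power_Suc)
  qed
qed auto

text \<open>When the number of factors is exactly \<open>card S\<close>, every \<open>p \<in> S\<close> is used once; choosing which of them come
from the first power produces \<open>e\<^sub>a\<close>.  Peeling off one factor turns the induction step into Euler's
identity.\<close>

lemma mixed_eq_esym:
  assumes "\<And>p. p \<notin> S \<Longrightarrow> area p * y = 0" and "card S = a + b"
  shows "mixed l a b * y = complex_of_real (fact a * fact b * esym l S a) *\<^sub>c (vol S * y)"
  using assms
proof (induction "a + b" arbitrary: a b S y)
  case 0
  then have "S = {}" by simp
  with 0 show ?case by simp
next
  case (Suc N)
  have IH: "mixed l a' b' * (area p * y) = complex_of_real (fact a' * fact b' * esym l (S - {p}) a') *\<^sub>c (vol S * y)"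
    if "a' + b' = N" "p \<in> S" for a' b' p
  proof -
    have "mixed l a' b' * (area p * y) =
        complex_of_real (fact a' * fact b' * esym l (S - {p}) a') *\<^sub>c (vol (S - {p}) * (area p * y))"
    proof (rule Suc.hyps(1)[of a' b' "S - {p}"])
      show "area q * (area p * y) = 0" if "q \<notin> S - {p}" for q
        using that Suc.prems(1)[of q] by (cases "q = p") (auto simp: area_commute'[of q p])
      show "card (S - {p}) = a' + b'" using that Suc by simp
    qed (use that in auto)
    also have "vol (S - {p}) * (area p * y) = vol S * y"
      using vol_remove[OF that(2)] area_vol by (simp flip: mult.assoc)
    finally show ?thesis .
  qed
  show ?case
  proof (cases a)
    case a: (Suc a')
    have "mixed l a b * y = (\<Sum>p\<in>S. complex_of_real (l p) *\<^sub>c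
        (complex_of_real (fact a' * fact b * esym l (S - {p}) a') *\<^sub>c (vol S * y)))"
      using IH[of a' b] Suc.hyps(2) unfolding a
      by (simp only: mixed_Suc_left diag_mult[OF Suc.prems(1)] sum_distrib_left)
         (auto simp del: power_Suc smul_simps intro!: sum.cong)
    also have "\<dots> = complex_of_real (fact a' * fact b * (\<Sum>p\<in>S. l p * esym l (S - {p}) a')) *\<^sub>c (vol S * y)"
      by (simp add: sum_distrib_left mult_ac flip: smul_sum(2))
    also have "\<dots> = complex_of_real (fact a * fact b * esym l S a) *\<^sub>c (vol S * y)"
      by (subst esym_euler) (simp_all add: a algebra_simps)
    finally show ?thesis .
  next
    case a: 0
    then obtain b' where b: "b = Suc b'" using Suc.hyps(2) by (cases b) auto
    have "mixed l a b * y = (\<Sum>p\<in>S. complex_of_real (fact b') *\<^sub>c (vol S * y))"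
      using IH[of a b'] Suc.hyps(2) unfolding b
      by (simp only: mixed_Suc_right diag_mult[OF Suc.prems(1)] sum_distrib_left)
         (auto simp del: power_Suc simp: a intro!: sum.cong)
    also have "\<dots> = (\<Sum>p\<in>S. complex_of_real (fact b')) *\<^sub>c (vol S * y)"
      by (simp only: smul_sum(2))
    also have "\<dots> = complex_of_real (fact a * fact b * esym l S a) *\<^sub>c (vol S * y)"
      using Suc.prems(2) by (simp add: a b)
    finally show ?thesis .
  qed
qed

lemma mixed_top:
  assumes "a + b = CARD('n)"
  shows "mixed l a b = complex_of_real (fact a * fact b * esym l UNIV a) *\<^sub>c vol UNIV"
  using mixed_eq_esym[of UNIV 1 a b l] assms by simp

lemma theta_theta_mixed:
  assumes "a + b = CARD('n) - 1"
  shows "\<theta> True p * \<theta> False q * mixed l a b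
     = (if p = q then (- \<i> * complex_of_real (fact a * fact b * esym l (- {p}) a)) *\<^sub>c vol UNIV else 0)"
proof -
  let ?y = "\<theta> True p * \<theta> False q"
  have comm: "?y * mixed l a b = mixed l a b * ?y"
    by (simp add: mixed_theta mixed_theta' mult.assoc)
  show ?thesis
  proof (cases "p = q")
    case True
    have "mixed l a b * ?y = complex_of_real (fact a * fact b * esym l (- {p}) a) *\<^sub>c (vol (- {p}) * ?y)"
      by (rule mixed_eq_esym) (use assms True in \<open>auto simp: card_Compl_finite area_theta' simp flip: mult.assoc\<close>)
    moreover have "vol (- {p}) * ?y = (- \<i>) *\<^sub>c vol UNIV"
      using vol_remove[of p UNIV] theta_pair[of True p] True by (simp add: area_vol Compl_eq_Diff_UNIV)
    ultimately show ?thesis using comm True by (simp add: mult_ac)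
  next
    case False
    have "mixed l a b * ?y = 0"
    proof (rule mixed_eq_0)
      show "area r * ?y = 0" if "r \<notin> - {p, q}" for r
        using that by (auto simp: area_theta'[of q True p])
      have "card (- {p, q}) = CARD('n) - 2" using False by (simp add: card_Compl_finite)
      moreover have "2 \<le> CARD('n)" using False card_mono[of "UNIV" "{p, q}"] by simp
      ultimately show "card (- {p, q}) < a + b" using assms by simp
    qed
    then show ?thesis using comm False by simp
  qed
qed

text \<open>A nonzero product of four elements has four different factors; if only two indices occur, these are both
kinds for each of the two indices, and sorting them costs a sign.\<close>

lemma theta4_cases:
  defines "y s1 p1 s2 p2 s3 p3 s4 p4 \<equiv> \<theta> s1 p1 * (\<theta> s2 p2 * (\<theta> s3 p3 * \<theta> s4 p4))"
  assumes "y s1 p1 s2 p2 s3 p3 s4 p4 \<noteq> 0" "card {p1, p2, p3, p4} \<le> 2"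
  obtains q c where "q \<noteq> p1" "cmod c = 1" "y s1 p1 s2 p2 s3 p3 s4 p4 = c *\<^sub>c (area p1 * area q)"
proof -
  have pair: "\<exists>c. cmod c = 1 \<and> \<theta> s p * (\<theta> (\<not> s) p * (\<theta> t q * \<theta> (\<not> t) q)) = c *\<^sub>c (area p * area q)" for s t p q
    by (rule exI[of _ "(if s then - \<i> else \<i>) * (if t then - \<i> else \<i>)"])
       (simp add: theta_pair norm_mult mult.assoc[symmetric])
  have nz: "y s1 p1 s2 p2 s3 p3 s4 p4 \<noteq> 0" by fact
  have "y s1 p1 s1 p1 s3 p3 s4 p4 = 0" "y s1 p1 s2 p2 s1 p1 s4 p4 = 0" "y s1 p1 s2 p2 s3 p3 s1 p1 = 0"
    "y s1 p1 s2 p2 s2 p2 s4 p4 = 0" "y s1 p1 s2 p2 s3 p3 s2 p2 = 0" "y s1 p1 s2 p2 s3 p3 s3 p3 = 0"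
    by (simp_all add: y_def anti'[of s2 p2 s1 p1] anti[of s3 p3 s1 p1] anti[of s3 p3 s2 p2])
  then have ne: "(s1, p1) \<noteq> (s2, p2)" "(s1, p1) \<noteq> (s3, p3)" "(s1, p1) \<noteq> (s4, p4)"
     "(s2, p2) \<noteq> (s3, p3)" "(s2, p2) \<noteq> (s4, p4)" "(s3, p3) \<noteq> (s4, p4)"
    using nz by (metis prod.inject)+
  have "\<exists>q c. q \<noteq> p1 \<and> cmod c = 1 \<and> y s1 p1 s2 p2 s3 p3 s4 p4 = c *\<^sub>c (area p1 * area q)"
  proof (cases "p2 = p1")
    case True
    have "p3 \<noteq> p1" "p4 \<noteq> p1" using ne True by auto
    moreover have "p4 = p3"
    proof (rule ccontr)
      assume "p4 \<noteq> p3"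
      then have "card {p1, p2, p3, p4} = 3" using True \<open>p3 \<noteq> p1\<close> \<open>p4 \<noteq> p1\<close> by (auto simp: card_insert_if)
      then show False using assms(3) by simp
    qed
    moreover have "s2 = (\<not> s1)" "s4 = (\<not> s3)" using ne True calculation by auto
    ultimately show ?thesis using pair[of s1 p1 s3 p3] True by (auto simp: y_def)
  next
    case False
    have mem: "r \<in> {p1, p2}" if "r \<in> {p1, p2, p3, p4}" for r
    proof (rule ccontr)
      assume "r \<notin> {p1, p2}"
      then have "card {p1, p2, r} = 3" using False by auto
      moreover have "card {p1, p2, r} \<le> card {p1, p2, p3, p4}" using that by (intro card_mono) auto
      ultimately show False using assms(3) by simp
    qed
    have p: "p3 \<in> {p1, p2}" "p4 \<in> {p1, p2}" using mem by auto
    obtain c where c: "cmod c = 1" "\<theta> s1 p1 * (\<theta> (\<not> s1) p1 * (\<theta> s2 p2 * \<theta> (\<not> s2) p2)) = c *\<^sub>c (area p1 * area p2)"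
      using pair by blast
    show ?thesis
    proof (cases "p3 = p1")
      case True
      then have "s3 = (\<not> s1)" "p4 = p2" "s4 = (\<not> s2)" using p ne by auto
      then have "y s1 p1 s2 p2 s3 p3 s4 p4 = (- c) *\<^sub>c (area p1 * area p2)"
        using True c anti'[of s2 p2 "\<not> s1" p1] by (simp add: y_def smul_distribs)
      then show ?thesis using False c by (intro exI[of _ p2] exI[of _ "- c"]) auto
    next
      case False2: False
      then have "p3 = p2" "s3 = (\<not> s2)" "p4 = p1" "s4 = (\<not> s1)" using p ne by auto
      then have "y s1 p1 s2 p2 s3 p3 s4 p4 = \<theta> s1 p1 * (\<theta> s2 p2 * (\<theta> (\<not> s2) p2 * \<theta> (\<not> s1) p1))"
        by (simp add: y_def)
      also have "\<dots> = c *\<^sub>c (area p1 * area p2)"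
        unfolding anti[of "\<not> s2" p2 "\<not> s1" p1] mult_minus_right anti'[of s2 p2 "\<not> s1" p1] minus_minus
        using c(2) by simp
      finally show ?thesis using False c by blast
    qed
  qed
  then show ?thesis using that by blast
qed

text \<open>If three or more indices occur, the product is annihilated by too many of the \<open>area p\<close> for the remaining
\<open>n - 2\<close> factors.  Otherwise the second index \<open>q\<close> is determined by the product; summing over all \<open>q\<close> gives a
bound that depends on the first index only.\<close>

lemma theta4_mixed_bound:
  assumes "a + b = CARD('n) - 2" "2 \<le> CARD('n)"
  shows "cmod (dens (\<theta> s1 p1 * (\<theta> s2 p2 * (\<theta> s3 p3 * \<theta> s4 p4)) * mixed l a b))
    \<le> fact a * fact b * cmod (dens (vol UNIV)) * (\<Sum>q\<in>- {p1}. \<bar>esym l (- {p1, q}) a\<bar>)"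
proof -
  let ?y = "\<theta> s1 p1 * (\<theta> s2 p2 * (\<theta> s3 p3 * \<theta> s4 p4))"
  let ?S = "- {p1, p2, p3, p4}"
  have nn: "0 \<le> fact a * fact b * cmod (dens (vol UNIV)) * (\<Sum>q\<in>- {p1}. \<bar>esym l (- {p1, q}) a\<bar>)"
    by (intro mult_nonneg_nonneg sum_nonneg) auto
  have comm: "?y * mixed l a b = mixed l a b * ?y"
    by (simp add: mixed_theta mixed_theta' mult.assoc)
  have kill: "area r * ?y = 0" if "r \<notin> ?S" for r
  proof -
    from that have "r = p1 \<or> r = p2 \<or> r = p3 \<or> r = p4" by auto
    then consider "r = p1" | "r = p2" | "r = p3" | "r = p4" by blast
    then show ?thesis
      by cases (simp_all add: area_theta'[of p2 s1 p1] area_theta'[of p3 s1 p1] area_theta'[of p3 s2 p2]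
          area_theta'[of p4 s1 p1] area_theta'[of p4 s2 p2] area_theta'[of p4 s3 p3])
  qed
  show ?thesis
  proof (cases "?y = 0 \<or> 2 < card {p1, p2, p3, p4}")
    case True
    have "mixed l a b * ?y = 0"
    proof (cases "?y = 0")
      case False
      show ?thesis
      proof (rule mixed_eq_0[OF kill])
        have "card {p1, p2, p3, p4} \<le> CARD('n)" by (rule card_mono) auto
        then show "card ?S < a + b"
          using True False assms card_Compl_finite[of "{p1, p2, p3, p4}"] by auto
      qed
    qed simp
    then show ?thesis using nn by (simp add: comm)
  next
    case False
    then have "?y \<noteq> 0" "card {p1, p2, p3, p4} \<le> 2" by auto
    then obtain q c where q: "q \<noteq> p1" "cmod c = 1" "?y = c *\<^sub>c (area p1 * area q)"
      by (rule theta4_cases)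
    have "mixed l a b * (area p1 * area q) = complex_of_real (fact a * fact b * esym l (- {p1, q}) a) *\<^sub>c (vol (- {p1, q}) * (area p1 * area q))"
      by (rule mixed_eq_esym) (use q assms in \<open>auto simp: card_Compl_finite area_commute'\<close>)
    also have "vol (- {p1, q}) * (area p1 * area q) = vol UNIV"
    proof -
      have "vol UNIV = area p1 * (area q * vol (- {p1, q}))"
        using vol_remove[of p1 UNIV] vol_remove[of q "UNIV - {p1}"] q
        by (auto simp: Compl_eq_Diff_UNIV insert_commute simp flip: Diff_insert2)
      also have "\<dots> = vol (- {p1, q}) * (area p1 * area q)"
        unfolding mult.assoc[symmetric] by (simp add: mult.assoc area_vol[of q]) (simp add: area_vol flip: mult.assoc)
      finally show ?thesis ..
    qed
    moreover have "?y * mixed l a b = c *\<^sub>c (mixed l a b * (area p1 * area q))"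
      by (subst comm, subst q(3)) simp
    ultimately have "?y * mixed l a b = (c * complex_of_real (fact a * fact b * esym l (- {p1, q}) a)) *\<^sub>c vol UNIV"
      by simp
    then have "cmod (dens (?y * mixed l a b)) = fact a * fact b * cmod (dens (vol UNIV)) * \<bar>esym l (- {p1, q}) a\<bar>"
      using q(2) by (simp add: norm_mult)
    also have "\<dots> \<le> fact a * fact b * cmod (dens (vol UNIV)) * (\<Sum>q\<in>- {p1}. \<bar>esym l (- {p1, q}) a\<bar>)"
      using q(1) by (intro mult_left_mono member_le_sum[of q "- {p1}" "\<lambda>q. \<bar>esym l (- {p1, q}) a\<bar>"]) auto
    finally show ?thesis .
  qed
qed

end

section \<open>Positivity of the volume element\<close>

text \<open>Here \<open>\<theta> False p\<close> is the conjugate of the \<open>(1,0)\<close>-form \<open>\<theta> True p\<close>.  Conjugation of one-forms involves no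
sign.\<close>

locale unitary_coframe = coframe \<theta> for \<theta> :: "bool \<Rightarrow> 'n \<Rightarrow> 'n::{finite,linorder} alt" +
  assumes hol: "J \<noteq> {} \<Longrightarrow> coeffs (\<theta> True p) I J = 0"
    and cnj: "coeffs (\<theta> False p) I J = cnj (coeffs (\<theta> True p) J I)"
begin

definition hprod :: "bool \<Rightarrow> 'n list \<Rightarrow> 'n alt" where
  "hprod s ps = prod_list (map (\<theta> s) ps)"

lemma hprod_hol: "J \<noteq> {} \<Longrightarrow> coeffs (hprod True ps) I J = 0"
proof (induction ps arbitrary: I J)
  case (Cons p ps)
  have "coeffs (\<theta> True p) A B * coeffs (hprod True ps) (I - A) (J - B) = 0" if "B \<subseteq> J" for A B
    using Cons.prems Cons.IH[of "J - B"] hol[of B p A] by (cases "B = {}") auto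
  then have "coeffs (\<theta> True p * hprod True ps) I J = 0"
    unfolding coeffs_simps ext_wedge_def by (intro sum.neutral ballI) (auto simp: mult.assoc)
  then show ?case by (simp add: hprod_def)
qed (simp add: hprod_def coeffs_simps ext_one_def)

lemma hprod_cnj: "coeffs (hprod False ps) I J = cnj (coeffs (hprod True ps) J I)"
proof (induction ps arbitrary: I J)
  case Nil
  show ?case by (simp add: hprod_def coeffs_simps ext_one_def)
next
  case (Cons p ps)
  have cnj_sh: "cnj (shuffle_sign A B) = shuffle_sign A B" for A B :: "'n set"
    by (simp add: shuffle_sign_def)
  have eq: "(- 1) ^ (card B * card (I - A)) * (cnj (coeffs (\<theta> True p) B A) * cnj (coeffs (hprod True ps) (J - B) (I - A)))
      = (- 1) ^ (card A * card (J - B)) * (cnj (coeffs (\<theta> True p) B A) * cnj (coeffs (hprod True ps) (J - B) (I - A)))"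
    for A B
    using hol[of A p B] hprod_hol[of "I - A" ps "J - B"] by (cases "A = {}"; cases "I - A = {}") auto
  have "coeffs (hprod False (p # ps)) I J = (\<Sum>A\<in>Pow I. \<Sum>B\<in>Pow J. shuffle_sign A (I - A) * shuffle_sign B (J - B) *
      ((- 1) ^ (card B * card (I - A)) * (cnj (coeffs (\<theta> True p) B A) * cnj (coeffs (hprod True ps) (J - B) (I - A)))))"
    using Cons.IH by (simp add: hprod_def coeffs_simps ext_wedge_def mult_ac local.cnj[of p])
  also have "\<dots> = (\<Sum>B\<in>Pow J. \<Sum>A\<in>Pow I. shuffle_sign A (I - A) * shuffle_sign B (J - B) *
      ((- 1) ^ (card A * card (J - B)) * (cnj (coeffs (\<theta> True p) B A) * cnj (coeffs (hprod True ps) (J - B) (I - A)))))"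
    unfolding eq by (rule sum.swap)
  also have "\<dots> = cnj (coeffs (hprod True (p # ps)) J I)"
    by (simp add: hprod_def coeffs_simps ext_wedge_def cnj_sh mult_ac)
  finally show ?case .
qed

lemma theta_hprod: "\<theta> s p * (hprod t ps * y) = (- 1) ^ length ps *\<^sub>c (hprod t ps * (\<theta> s p * y))"
proof (induction ps arbitrary: y)
  case Nil
  show ?case by (simp add: hprod_def)
next
  case (Cons q ps)
  have "\<theta> s p * (hprod t (q # ps) * y) = - (\<theta> t q * (\<theta> s p * (hprod t ps * y)))"
    by (simp add: hprod_def mult.assoc anti'[of s p t q])
  also have "\<dots> = - ((- 1) ^ length ps *\<^sub>c (\<theta> t q * (hprod t ps * (\<theta> s p * y))))"
    by (simp add: Cons.IH)
  also have "\<dots> = (- 1) ^ length (q # ps) *\<^sub>c (hprod t (q # ps) * (\<theta> s p * y))"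
    by (simp add: hprod_def mult.assoc smul_distribs)
  finally show ?case .
qed

text \<open>Moving all \<open>(1,0)\<close>-factors to the left costs \<open>(-1)\<^bsup>k (k - 1) / 2\<^esup>\<close>.\<close>

lemma vol_hprod:
  assumes "distinct ps"
  shows "vol (set ps) = (\<i> ^ length ps * (- 1) ^ (length ps * (length ps - 1) div 2)) *\<^sub>c (hprod True ps * hprod False ps)"
  using assms
proof (induction ps)
  case Nil
  show ?case by (simp add: hprod_def)
next
  case (Cons p ps)
  let ?k = "length ps"
  have "(Suc ?k * ?k) div 2 = ?k * (?k - 1) div 2 + ?k"
  proof -
    have "Suc ?k * ?k = ?k * (?k - 1) + 2 * ?k" by (cases ?k) auto
    then show ?thesis by simp
  qed
  then have sign: "(- 1) ^ (Suc ?k * ?k div 2) = (- 1) ^ (?k * (?k - 1) div 2) * (- 1 :: complex) ^ ?k"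
    by (simp add: power_add)
  have "vol (set (p # ps)) = area p * vol (set ps)" using Cons.prems by (simp add: vol_insert)
  also have "\<dots> = (\<i> ^ ?k * (- 1) ^ (?k * (?k - 1) div 2)) *\<^sub>c (area p * (hprod True ps * hprod False ps))"
    using Cons by simp
  also have "area p * (hprod True ps * hprod False ps)
      = (\<i> * (- 1) ^ ?k) *\<^sub>c (\<theta> True p * (hprod True ps * (\<theta> False p * hprod False ps)))"
    by (simp add: area_def mult.assoc theta_hprod[of False p True])
  also have "\<dots> = (\<i> * (- 1) ^ ?k) *\<^sub>c (hprod True (p # ps) * hprod False (p # ps))"
    by (simp add: hprod_def mult.assoc)
  finally show ?case using sign by (simp add: mult_ac)
qed

text \<open>The product of the \<open>\<theta> True p\<close> is \<open>c dz\<^sub>1 \<and> \<dots> \<and> dz\<^sub>n\<close> for some \<open>c\<close>, and that of the \<open>\<theta> False p\<close> has the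
conjugate coefficient, so the density is \<open>2\<^sup>n |c|\<^sup>2\<close>: the signs and powers of \<open>\<i>\<close> cancel those in the normalisation.\<close>

lemma dens_vol: "\<exists>r\<ge>0. dens (vol UNIV) = complex_of_real r"
proof -
  obtain ps where ps: "set ps = (UNIV :: 'n set)" "distinct ps"
    using finite_distinct_list[of "UNIV :: 'n set"] by auto
  then have len: "length ps = CARD('n)" using distinct_card by fastforce
  define A B where "A = coeffs (hprod True ps)" and "B = coeffs (hprod False ps)"
  have "coeffs (hprod True ps * hprod False ps) UNIV UNIV
     = (\<Sum>I\<in>(UNIV :: 'n set set). \<Sum>J\<in>(UNIV :: 'n set set). if J = {} then (if I = UNIV then A UNIV {} * B {} UNIV else 0) else 0)"
    unfolding coeffs_simps ext_wedge_def Pow_UNIV A_def B_def hprod_cnj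
  proof (intro sum.cong refl)
    fix I J :: "'n set"
    show "(- 1) ^ (card J * card (UNIV - I)) * shuffle_sign I (UNIV - I) * shuffle_sign J (UNIV - J) *
        coeffs (hprod True ps) I J * cnj (coeffs (hprod True ps) (UNIV - J) (UNIV - I))
      = (if J = {} then if I = UNIV then coeffs (hprod True ps) UNIV {} * cnj (coeffs (hprod True ps) UNIV {}) else 0 else 0)"
      using hprod_hol[of J ps I] hprod_hol[of "UNIV - I" ps "UNIV - J"]
      by (cases "J = {}"; cases "UNIV - I = {}") auto
  qed
  also have "\<dots> = A UNIV {} * cnj (A UNIV {})"
    by (simp add: sum.delta A_def B_def hprod_cnj)
  also have "\<dots> = complex_of_real ((cmod (A UNIV {}))\<^sup>2)"
    using complex_norm_square[of "A UNIV {}"] by simp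
  finally have AB: "coeffs (hprod True ps * hprod False ps) UNIV UNIV = complex_of_real ((cmod (A UNIV {}))\<^sup>2)" .
  have "dens (vol UNIV) = complex_of_real (2 ^ CARD('n) * (cmod (A UNIV {}))\<^sup>2)"
    using vol_hprod[OF ps(2)] unfolding ps(1) len
    by (simp add: dens_def ext_density_def coeffs_smul AB power_divide)
  then show ?thesis by (intro exI[of _ "2 ^ CARD('n) * (cmod (A UNIV {}))\<^sup>2"]) auto
qed

end

section \<open>Simultaneous diagonalisation of Hermitian forms\<close>

definition herm :: "('n::finite \<Rightarrow> 'n \<Rightarrow> complex) \<Rightarrow> complex ^ 'n \<Rightarrow> complex ^ 'n \<Rightarrow> complex" where
  "herm g u v = (\<Sum>i\<in>UNIV. \<Sum>j\<in>UNIV. g i j * u $ i * cnj (v $ j))"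

lemma herm_add_left: "herm g (u + v) w = herm g u w + herm g v w"
  by (simp add: herm_def algebra_simps sum.distrib)

lemma herm_scale_left: "herm g (c *s u) v = c * herm g u v"
  by (simp add: herm_def sum_distrib_left mult_ac)

lemma herm_diff_left: "herm g (u - v) w = herm g u w - herm g v w"
  by (simp add: herm_def algebra_simps sum_subtractf)

lemma herm_zero_left [simp]: "herm g 0 v = 0"
  by (simp add: herm_def)

lemma herm_sum_left: "herm g (\<Sum>i\<in>S. f i) v = (\<Sum>i\<in>S. herm g (f i) v)"
  by (induction S rule: infinite_finite_induct) (simp_all add: herm_add_left)

lemma herm_cnj:
  assumes "\<And>i j. g j i = cnj (g i j)"
  shows "herm g v u = cnj (herm g u v)"
proof -
  have "cnj (herm g u v) = (\<Sum>i\<in>UNIV. \<Sum>j\<in>UNIV. g j i * v $ j * cnj (u $ i))"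
    by (simp add: herm_def assms[symmetric] mult_ac)
  also have "\<dots> = herm g v u"
    unfolding herm_def by (rule sum.swap)
  finally show ?thesis ..
qed

lemma herm_add_right: "herm g u (v + w) = herm g u v + herm g u w"
  by (simp add: herm_def algebra_simps sum.distrib)

lemma herm_scale_right: "herm g u (c *s v) = cnj c * herm g u v"
  by (simp add: herm_def sum_distrib_left mult_ac)

lemma herm_diff_form: "herm (\<lambda>i j. c * g i j - h i j) u v = c * herm g u v - herm h u v"
  by (simp add: herm_def algebra_simps sum_subtractf sum_distrib_left)

lemma continuous_on_herm [continuous_intros]:
  "continuous_on S f \<Longrightarrow> continuous_on S f' \<Longrightarrow> continuous_on S (\<lambda>x. herm g (f x) (f' x))"
  unfolding herm_def by (intro continuous_intros)

text \<open>A zero of a Hermitian form that is nonnegative on \<open>W\<close> lies in its kernel there: \<open>t \<mapsto> m(e + t c w, e + t c w)\<close>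
is a nonnegative quadratic polynomial without constant term, so its linear coefficient vanishes for every
complex \<open>c\<close>.\<close>

lemma herm_kernel:
  assumes H: "\<And>i j. m j i = cnj (m i j)"
    and W: "\<And>u v c. u \<in> W \<Longrightarrow> v \<in> W \<Longrightarrow> u + c *s v \<in> W"
    and nonneg: "\<And>v. v \<in> W \<Longrightarrow> 0 \<le> Re (herm m v v)"
    and e: "e \<in> W" "Re (herm m e e) = 0" and w: "w \<in> W"
  shows "herm m w e = 0"
proof -
  have "(Re (c * herm m w e)) = 0" for c
  proof (rule ccontr)
    define b where "b = Re (c * herm m w e)"
    define C where "C = (cmod c)\<^sup>2 * Re (herm m w w)"
    assume "Re (c * herm m w e) \<noteq> 0"
    then have b: "b \<noteq> 0" by (simp add: b_def)
    have "0 \<le> C" using nonneg[OF w] by (simp add: C_def)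
    \<comment> \<open>the minimiser of \<open>2 t b + t\<^sup>2 (C + 1)\<close>; the added \<open>1\<close> covers the case \<open>C = 0\<close>\<close>
    define t where "t = - b / (C + 1)"
    have cc: "c * cnj c = of_real ((cmod c)\<^sup>2)" using complex_norm_square[of c] by simp
    have imw: "Im (herm m w w) = 0" using herm_cnj[OF H, where v = w and u = w] by (simp add: complex_eq_iff)
    have "0 \<le> Re (herm m (e + (of_real t * c) *s w) (e + (of_real t * c) *s w))"
      by (intro nonneg W e w)
    also have "herm m (e + (of_real t * c) *s w) (e + (of_real t * c) *s w) =
        herm m e e + of_real t * (c * herm m w e + cnj (c * herm m w e)) + of_real (t\<^sup>2) * (c * cnj c * herm m w w)"
      using herm_cnj[OF H, where v = e and u = w]
      by (simp add: herm_add_left herm_add_right herm_scale_left herm_scale_right algebra_simps power2_eq_square)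
    also have "Re \<dots> = 2 * t * b + t\<^sup>2 * C"
      unfolding cc using e(2) imw by (simp add: b_def C_def flip: of_real_power)
    also have "\<dots> = - (b\<^sup>2 * (C + 2)) / (C + 1)\<^sup>2"
      using \<open>0 \<le> C\<close> by (simp add: t_def divide_simps power2_eq_square) (simp add: algebra_simps)
    also have "\<dots> < 0"
      using b \<open>0 \<le> C\<close> by (auto simp: divide_simps mult_less_0_iff zero_less_mult_iff)
    finally show False by simp
  qed
  from this[of 1] this[of "\<i>"] show ?thesis by (simp add: complex_eq_iff)
qed

text \<open>The matrix whose row \<open>p\<close> is \<open>g(\<cdot>, e\<^sub>p)\<close> for \<open>p \<in> I\<close> and zero otherwise has a zero row, so it is not
surjective and has a kernel.\<close>

lemma exists_orthogonal_vector:
  fixes e :: "'n::finite \<Rightarrow> complex ^ 'n"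
  assumes "q \<notin> I"
  shows "\<exists>v. v \<noteq> 0 \<and> (\<forall>p\<in>I. herm g v (e p) = 0)"
proof -
  define M :: "complex ^ 'n ^ 'n" where
    "M = (\<chi> p i. if p \<in> I then \<Sum>j\<in>UNIV. g i j * cnj (e p $ j) else 0)"
  have M: "(M *v v) $ p = (if p \<in> I then herm g v (e p) else 0)" for v p
    by (simp add: M_def matrix_vector_mult_def herm_def sum_distrib_left sum_distrib_right mult_ac)
  have "\<exists>v. M *v v = 0 \<and> v \<noteq> 0"
  proof (rule ccontr)
    assume "\<not> (\<exists>v. M *v v = 0 \<and> v \<noteq> 0)"
    then obtain B where "B ** M = mat 1" using matrix_left_invertible_ker by blast
    then have "M ** B = mat 1" by (simp add: matrix_left_right_inverse)
    then have "M *v (B *v axis q 1) = axis q 1" by (simp add: matrix_vector_mul_assoc)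
    then have "(axis q 1 :: complex ^ 'n) $ q = 0" using M[of "B *v axis q 1" q] assms by simp
    then show False by simp
  qed
  then obtain v where "M *v v = 0" "v \<noteq> 0" by blast
  moreover have "herm g v (e p) = 0" if "p \<in> I" for p
    using M[of v p] calculation that by simp
  ultimately show ?thesis by blast
qed

text \<open>The next eigenvector maximises the Rayleigh quotient \<open>h(v, v) / g(v, v)\<close> on the \<open>g\<close>-orthogonal complement \<open>W\<close>
of those already found.  With \<open>r\<close> the maximum, \<open>r g - h\<close> is nonnegative on \<open>W\<close> and vanishes at the maximiser,
which therefore lies in its kernel on \<open>W\<close>; the span of the earlier eigenvectors is orthogonal to \<open>W\<close> for both
forms, so the eigenvector equation holds on the whole space.\<close>

lemma herm_eigenvector_step:
  fixes g h :: "'n::finite \<Rightarrow> 'n \<Rightarrow> complex" and e :: "'n \<Rightarrow> complex ^ 'n"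
  assumes Hg: "\<And>i j. g j i = cnj (g i j)" and Hh: "\<And>i j. h j i = cnj (h i j)"
    and pos: "\<And>v. v \<noteq> 0 \<Longrightarrow> 0 < Re (herm g v v)" and q: "q \<notin> I"
    and orth: "\<And>p p'. p \<in> I \<Longrightarrow> p' \<in> I \<Longrightarrow> herm g (e p) (e p') = (if p = p' then 1 else 0)"
    and eig: "\<And>p v. p \<in> I \<Longrightarrow> herm h v (e p) = of_real (l p) * herm g v (e p)"
  shows "\<exists>u r. herm g u u = 1 \<and> (\<forall>p\<in>I. herm g u (e p) = 0) \<and> (\<forall>v. herm h v u = complex_of_real r * herm g v u)"
proof -
  define W where "W = {v. \<forall>p\<in>I. herm g v (e p) = 0}"
  have W: "u + c *s v \<in> W" if "u \<in> W" "v \<in> W" for u v c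
    using that by (simp add: W_def herm_add_left herm_scale_left)
  define R where "R v = Re (herm h v v) / Re (herm g v v)" for v
  have real: "herm g v v = of_real (Re (herm g v v))" "herm h v v = of_real (Re (herm h v v))" for v
    using herm_cnj[OF Hg, where v = v and u = v] herm_cnj[OF Hh, where v = v and u = v] by (auto simp: complex_eq_iff)
  have R_scale: "R (c *s v) = R v" if "c \<noteq> 0" for c v
  proof -
    have "herm g (c *s v) (c *s v) = of_real ((cmod c)\<^sup>2) * herm g v v"
         "herm h (c *s v) (c *s v) = of_real ((cmod c)\<^sup>2) * herm h v v"
      by (simp_all add: herm_scale_left herm_scale_right complex_norm_square mult_ac flip: of_real_power)
    then show ?thesis using that by (simp add: R_def)
  qed
  have W_eq: "W = (\<Inter>p\<in>I. {v. herm g v (e p) = 0})" by (auto simp: W_def)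
  have "closed W"
    unfolding W_eq by (intro closed_INT ballI closed_Collect_eq continuous_intros)
  then have "compact (W \<inter> sphere 0 1)" by (intro closed_Int_compact compact_sphere)
  moreover have ex: "inverse (complex_of_real (norm v)) *s v \<in> W \<inter> sphere 0 1" if "v \<in> W" "v \<noteq> 0" for v
  proof -
    have "inverse (complex_of_real (norm v)) *s v = inverse (norm v) *\<^sub>R v"
      unfolding vec_eq_iff vector_scaleR_component vector_smult_component by (simp add: scaleR_conv_of_real)
    moreover have "norm (inverse (norm v) *\<^sub>R v) = 1" using that by simp
    ultimately show ?thesis using W[of 0 v "inverse (complex_of_real (norm v))"] that by (auto simp: W_def)
  qed
  moreover obtain v0 where "v0 \<noteq> 0" "v0 \<in> W"
    using exists_orthogonal_vector[OF q, of g e] by (auto simp: W_def)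
  moreover have "continuous_on (W \<inter> sphere 0 1) R"
    unfolding R_def
  proof (intro continuous_intros ballI)
    fix v assume "v \<in> W \<inter> sphere 0 1"
    then have "v \<noteq> 0" by auto
    then show "Re (herm g v v) \<noteq> 0" using pos[of v] by simp
  qed
  ultimately obtain u0 where u0: "u0 \<in> W \<inter> sphere 0 1" "\<And>v. v \<in> W \<inter> sphere 0 1 \<Longrightarrow> R v \<le> R u0"
    using continuous_attains_sup[of "W \<inter> sphere 0 1" R] by blast
  have "u0 \<noteq> 0" using u0 by auto
  have max: "Re (herm h v v) \<le> R u0 * Re (herm g v v)" if "v \<in> W" for v
  proof (cases "v = 0")
    case False
    then have "R v \<le> R u0"
      using u0(2)[OF ex[OF that False]] R_scale[of "inverse (complex_of_real (norm v))" v] by simp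
    then show ?thesis using pos[OF False] by (simp add: R_def pos_divide_le_eq)
  qed simp
  define a where "a = Re (herm g u0 u0)"
  have a: "0 < a" using pos \<open>u0 \<noteq> 0\<close> by (simp add: a_def)
  define u where "u = complex_of_real (1 / sqrt a) *s u0"
  define r where "r = R u0"
  have "u \<in> W" using W[of 0 u0] u0 by (auto simp: u_def W_def)
  have "herm g u0 u0 = complex_of_real a" using real(1)[of u0] by (simp add: a_def)
  moreover have "herm g u u = complex_of_real (1 / sqrt a) * (complex_of_real (1 / sqrt a) * herm g u0 u0)"
    unfolding u_def herm_scale_left herm_scale_right by simp
  ultimately have "herm g u u = complex_of_real (1 / sqrt a * (1 / sqrt a * a))"
    by (simp only: of_real_mult)
  moreover have "1 / sqrt a * (1 / sqrt a * a) = 1" using a by (simp add: field_simps)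
  ultimately have gu: "herm g u u = 1" by simp
  let ?m = "\<lambda>i j. complex_of_real r * g i j - h i j"
  have Hm: "?m j i = cnj (?m i j)" for i j using Hg[of j i] Hh[of j i] by simp
  have "r = R u" using R_scale[of "complex_of_real (1 / sqrt a)" u0] a by (simp add: r_def u_def)
  then have mu: "Re (herm ?m u u) = 0" using gu by (simp add: herm_diff_form R_def)
  have "herm ?m w u = 0" if "w \<in> W" for w
    by (rule herm_kernel[OF Hm W _ \<open>u \<in> W\<close> mu that])
       (use max in \<open>auto simp: herm_diff_form r_def\<close>)
  then have kerW: "herm h w u = of_real r * herm g w u" if "w \<in> W" for w
    using that by (simp add: herm_diff_form)
  have "herm h v u = of_real r * herm g v u" for v
  proof -
    define s where "s = (\<Sum>p\<in>I. herm g v (e p) *s e p)"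
    have zero: "herm g (e p) u = 0" "herm h (e p) u = 0" if "p \<in> I" for p
      using herm_cnj[OF Hg, where v = "e p" and u = u] herm_cnj[OF Hh, where v = "e p" and u = u] eig[OF that, of u] \<open>u \<in> W\<close> that
      by (auto simp: W_def)
    have "herm g s (e p) = herm g v (e p)" if "p \<in> I" for p
      using that by (simp add: s_def herm_sum_left herm_scale_left orth if_distrib[of "(*) _"] sum.delta cong: sum.cong if_cong)
    then have "v - s \<in> W" by (simp add: W_def herm_diff_left)
    then have "herm h (v - s) u = of_real r * herm g (v - s) u" by (rule kerW)
    moreover have "herm g s u = 0" "herm h s u = 0"
      by (simp_all add: s_def herm_sum_left herm_scale_left zero)
    ultimately show ?thesis by (simp add: herm_diff_left)
  qed
  then show ?thesis using gu \<open>u \<in> W\<close> by (auto simp: W_def)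
qed

lemma simultaneous_diagonalisation:
  fixes g h :: "'n::finite \<Rightarrow> 'n \<Rightarrow> complex"
  assumes Hg: "\<And>i j. g j i = cnj (g i j)" and Hh: "\<And>i j. h j i = cnj (h i j)"
    and pos: "\<And>v. v \<noteq> 0 \<Longrightarrow> 0 < Re (herm g v v)"
  obtains e :: "'n \<Rightarrow> complex ^ 'n" and l :: "'n \<Rightarrow> real"
  where "\<And>p q. herm g (e p) (e q) = (if p = q then 1 else 0)"
    and "\<And>p q. herm h (e p) (e q) = (if p = q then of_real (l p) else 0)"
proof -
  have "\<exists>(e :: 'n \<Rightarrow> complex ^ 'n) (l :: 'n \<Rightarrow> real).
     (\<forall>p\<in>I. \<forall>p'\<in>I. herm g (e p) (e p') = (if p = p' then 1 else 0)) \<and>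
     (\<forall>p\<in>I. \<forall>v. herm h v (e p) = of_real (l p) * herm g v (e p))" for I :: "'n set"
    using finite[of I]
  proof (induction I)
    case (insert q I)
    then obtain e l where e:
      "\<And>p p'. p \<in> I \<Longrightarrow> p' \<in> I \<Longrightarrow> herm g (e p) (e p') = (if p = p' then 1 else 0)"
      "\<And>p v. p \<in> I \<Longrightarrow> herm h v (e p) = of_real (l p) * herm g v (e p)" by blast
    obtain u r where u: "herm g u u = 1" "\<And>p. p \<in> I \<Longrightarrow> herm g u (e p) = 0"
        "\<And>v. herm h v u = complex_of_real r * herm g v u"
      using herm_eigenvector_step[OF Hg Hh pos insert.hyps(2) e] by blast
    have u': "herm g (e p) u = 0" if "p \<in> I" for p
      using herm_cnj[OF Hg, where v = "e p" and u = u] u(2)[OF that] by simp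
    have "p \<noteq> q" if "p \<in> I" for p using that insert by auto
    then show ?case using e u u' insert.hyps(2)
      by (intro exI[of _ "e(q := u)"] exI[of _ "l(q := r)"]) auto
  qed auto
  from this[of UNIV] obtain e :: "'n \<Rightarrow> complex ^ 'n" and l :: "'n \<Rightarrow> real" where
    "\<And>p q. herm g (e p) (e q) = (if p = q then 1 else 0)"
    "\<And>p v. herm h v (e p) = of_real (l p) * herm g v (e p)" by auto
  then show ?thesis by (intro that[of e l]) auto
qed

lemma orthonormal_dual:
  fixes e :: "'n::finite \<Rightarrow> complex ^ 'n"
  assumes "\<And>p q. herm g (e p) (e q) = (if p = q then 1 else 0)"
  obtains F :: "'n \<Rightarrow> 'n \<Rightarrow> complex" where "\<And>i j. (\<Sum>p\<in>UNIV. e p $ j * F p i) = (if i = j then 1 else 0)"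
proof -
  define F where "F p i = (\<Sum>k\<in>UNIV. g i k * cnj (e p $ k))" for p i
  define M N :: "complex ^ 'n ^ 'n" where "M = (\<chi> p i. F p i)" and "N = (\<chi> j p. e p $ j)"
  have "(\<Sum>i\<in>UNIV. F p i * e q $ i) = herm g (e q) (e p)" for p q
    by (simp add: F_def herm_def sum_distrib_left sum_distrib_right mult_ac)
  then have "M ** N = mat 1"
    by (auto simp: M_def N_def matrix_matrix_mult_def mat_def vec_eq_iff assms)
  then have "N ** M = mat 1" by (simp add: matrix_left_right_inverse)
  then have "(N ** M) $ j $ i = (if i = j then 1 else 0)" for i j by (simp add: mat_def)
  then show ?thesis
    by (intro that[of F]) (simp add: M_def N_def matrix_matrix_mult_def)
qed

section \<open>Coframes adapted to two (1,1)-forms\<close>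

lemma coeffs_gen_pair:
  "coeffs (gen True i * gen False j) I J = (if I = {i} \<and> J = {j} then 1 else 0)"
  for i j :: "'n::{finite,linorder}"
  by (simp add: coeffs_simps coeffs_gen ext_wedge_basis wedge_sign_def) (simp add: ext_basis_def)

lemma alt_11_expansion:
  fixes a :: "'n::{finite,linorder} alt"
  assumes "\<And>I J. coeffs a I J \<noteq> 0 \<Longrightarrow> card I = 1 \<and> card J = 1"
  shows "a = (\<Sum>i\<in>UNIV. \<Sum>j\<in>UNIV. coeffs a {i} {j} *\<^sub>c (gen True i * gen False j))"
proof (rule alt_eqI)
  fix I J :: "'n set"
  have *: "coeffs (\<Sum>i\<in>UNIV. \<Sum>j\<in>UNIV. coeffs a {i} {j} *\<^sub>c (gen True i * gen False j)) I J
     = (\<Sum>i\<in>UNIV. \<Sum>j\<in>UNIV. if I = {i} \<and> J = {j} then coeffs a {i} {j} else 0)"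
    by (simp add: coeffs_sum coeffs_smul coeffs_gen_pair if_distrib[of "(*) _"] cong: if_cong)
  show "coeffs a I J = coeffs (\<Sum>i\<in>UNIV. \<Sum>j\<in>UNIV. coeffs a {i} {j} *\<^sub>c (gen True i * gen False j)) I J"
  proof (cases "\<exists>i j. I = {i} \<and> J = {j}")
    case True
    then obtain i j where "I = {i}" "J = {j}" by blast
    moreover have "(\<Sum>i'\<in>UNIV. \<Sum>j'\<in>UNIV. if {i} = {i'} \<and> {j} = {j'} then coeffs a {i'} {j'} else 0)
        = (\<Sum>i'\<in>UNIV. if i' = i then (\<Sum>j'\<in>UNIV. if j' = j then coeffs a {i'} {j'} else 0) else 0)"
      by (intro sum.cong refl) auto
    ultimately show ?thesis unfolding * by (simp add: sum.delta)
  next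
    case False
    then have "coeffs a I J = 0" using assms[of I J] by (meson card_1_singletonE)
    moreover have "(\<Sum>i\<in>UNIV. \<Sum>j\<in>UNIV. if I = {i} \<and> J = {j} then coeffs a {i} {j} else 0) = 0"
      using False by (intro sum.neutral ballI) auto
    ultimately show ?thesis unfolding * by simp
  qed
qed

lemma sum_swap4:
  "(\<Sum>i\<in>A. \<Sum>j\<in>B. \<Sum>p\<in>C. \<Sum>q\<in>D. f i j p q) = (\<Sum>p\<in>C. \<Sum>q\<in>D. \<Sum>i\<in>A. \<Sum>j\<in>B. f i j p q)"
proof -
  have "(\<Sum>i\<in>A. \<Sum>j\<in>B. \<Sum>p\<in>C. \<Sum>q\<in>D. f i j p q) = (\<Sum>i\<in>A. \<Sum>p\<in>C. \<Sum>j\<in>B. \<Sum>q\<in>D. f i j p q)"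
    by (intro sum.cong[OF refl] sum.swap)
  also have "\<dots> = (\<Sum>p\<in>C. \<Sum>i\<in>A. \<Sum>j\<in>B. \<Sum>q\<in>D. f i j p q)"
    by (rule sum.swap)
  also have "\<dots> = (\<Sum>p\<in>C. \<Sum>i\<in>A. \<Sum>q\<in>D. \<Sum>j\<in>B. f i j p q)"
    by (intro sum.cong[OF refl] sum.swap)
  also have "\<dots> = (\<Sum>p\<in>C. \<Sum>q\<in>D. \<Sum>i\<in>A. \<Sum>j\<in>B. f i j p q)"
    by (intro sum.cong[OF refl] sum.swap)
  finally show ?thesis .
qed

lemma smul_sum_product:
  fixes f g :: "_ \<Rightarrow> 'n::{finite,linorder} alt"
  shows "(\<Sum>i\<in>A. a i *\<^sub>c f i) * (\<Sum>j\<in>B. b j *\<^sub>c g j) = (\<Sum>i\<in>A. \<Sum>j\<in>B. (a i * b j) *\<^sub>c (f i * g j))"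
  by (simp add: sum_product mult.commute)

text \<open>The coframe \<open>\<theta>\<close> is dual to a basis \<open>e\<close> that is orthonormal for \<open>w\<close> and orthogonal for \<open>y\<close>, so that
\<open>dz\<^sub>j = \<Sum> (e\<^sub>p)\<^sub>j \<theta>\<^sub>p\<close>.  The bound on the transition coefficients \<open>E\<close> comes from
\<open>c |e\<^sub>p|\<^sup>2 \<le> w(e\<^sub>p, e\<^sub>p) = 1\<close>.\<close>

lemma unitary_coframe_exists:
  fixes w y :: "'n::{finite,linorder} alt"
  assumes w11: "\<And>I J. coeffs w I J \<noteq> 0 \<Longrightarrow> card I = 1 \<and> card J = 1"
    and y11: "\<And>I J. coeffs y I J \<noteq> 0 \<Longrightarrow> card I = 1 \<and> card J = 1"
    and wreal: "ext_cnj (coeffs w) = coeffs w" and yreal: "ext_cnj (coeffs y) = coeffs y"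
    and c: "0 < c" "\<And>v. c * (norm v)\<^sup>2 \<le> Re (herm (\<lambda>i j. coeffs w {i} {j} / \<i>) v v)"
  obtains \<theta> l E where "unitary_coframe \<theta>"
    "w = coframe.diag \<theta> (\<lambda>_. 1)" "y = coframe.diag \<theta> l"
    "\<And>s j. gen s j = (\<Sum>p\<in>UNIV. E s p j *\<^sub>c \<theta> s p)"
    "\<And>s p j. cmod (E s p j) \<le> 1 / sqrt c" "\<And>p j. E False p j = cnj (E True p j)"
proof -
  let ?g = "\<lambda>i j. coeffs w {i} {j} / \<i>" and ?h = "\<lambda>i j. coeffs y {i} {j} / \<i>"
  have H: "coeffs u {j} {i} / \<i> = cnj (coeffs u {i} {j} / \<i>)" if "ext_cnj (coeffs u) = coeffs u" for u :: "'n alt" and i j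
  proof -
    have "coeffs u {j} {i} = - cnj (coeffs u {i} {j})"
      using fun_cong[OF fun_cong[OF that, of "{j}"], of "{i}"] by (simp add: ext_cnj_def)
    then show ?thesis by (simp add: field_simps)
  qed
  have pos: "0 < Re (herm ?g v v)" if "v \<noteq> 0" for v
    using c(2)[of v] c(1) that by (smt (verit) mult_pos_pos zero_less_power zero_less_norm_iff)
  obtain e l where
    eg: "\<And>p q :: 'n. herm ?g (e p) (e q) = (if p = q then 1 else 0)" and
    eh: "\<And>p q :: 'n. herm ?h (e p) (e q) = (if p = q then of_real (l p) else 0)"
    by (rule simultaneous_diagonalisation[of ?g ?h, OF H[OF wreal] H[OF yreal] pos]) blast+
  obtain F where F: "\<And>i j. (\<Sum>p\<in>UNIV. e p $ j * F p i) = (if i = j then 1 else 0)"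
    by (rule orthonormal_dual[of ?g e, OF eg]) blast+
  define E where "E s p j = (if s then e p $ j else cnj (e p $ j))" for s p j
  define \<theta> where "\<theta> s p = (\<Sum>i\<in>UNIV. (if s then F p i else cnj (F p i)) *\<^sub>c gen s i)" for s p
  have gen: "gen s j = (\<Sum>p\<in>UNIV. E s p j *\<^sub>c \<theta> s p)" for s j
  proof -
    have F': "(\<Sum>p\<in>UNIV. E s p j * (if s then F p i else cnj (F p i))) = (if i = j then 1 else 0)" for i
    proof -
      have "(\<Sum>p\<in>UNIV. cnj (e p $ j) * cnj (F p i)) = cnj (\<Sum>p\<in>UNIV. e p $ j * F p i)" by simp
      then show ?thesis using F[where i = i and j = j] by (cases s) (simp_all only: E_def if_True if_False, auto)
    qed
    have "(\<Sum>p\<in>UNIV. E s p j *\<^sub>c \<theta> s p) = (\<Sum>p\<in>UNIV. \<Sum>i\<in>UNIV. (E s p j * (if s then F p i else cnj (F p i))) *\<^sub>c gen s i)"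
      by (simp add: \<theta>_def smul_sum)
    also have "\<dots> = (\<Sum>i\<in>UNIV. (\<Sum>p\<in>UNIV. E s p j * (if s then F p i else cnj (F p i))) *\<^sub>c gen s i)"
      by (subst sum.swap) (simp only: smul_sum(2))
    also have "\<dots> = (\<Sum>i\<in>UNIV. if i = j then gen s i else 0)"
      unfolding F' by (intro sum.cong refl) auto
    finally show ?thesis by simp
  qed
  have cofr: "unitary_coframe \<theta>"
  proof
    show "\<theta> s p * \<theta> t q = - (\<theta> t q * \<theta> s p)" for s p t q
    proof -
      have "\<theta> s p * \<theta> t q = (\<Sum>i\<in>UNIV. \<Sum>j\<in>UNIV. ((if s then F p i else cnj (F p i)) * (if t then F q j else cnj (F q j))) *\<^sub>c (gen s i * gen t j))"
        unfolding \<theta>_def by (rule smul_sum_product)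
      also have "\<dots> = - (\<Sum>i\<in>UNIV. \<Sum>j\<in>UNIV. ((if s then F p i else cnj (F p i)) * (if t then F q j else cnj (F q j))) *\<^sub>c (gen t j * gen s i))"
        unfolding sum_negf[symmetric] by (intro sum.cong refl, subst gen_anticommute) (simp add: smul_distribs)
      also have "\<dots> = - (\<theta> t q * \<theta> s p)"
        unfolding \<theta>_def smul_sum_product by (subst sum.swap) (simp only: mult.commute)
      finally show ?thesis .
    qed
    show "coeffs (\<theta> True p) I J = 0" if "J \<noteq> {}" for I J p
      using that by (simp add: \<theta>_def coeffs_sum coeffs_smul coeffs_gen ext_basis_def)
    show "coeffs (\<theta> False p) I J = cnj (coeffs (\<theta> True p) J I)" for I J p
      by (simp add: \<theta>_def coeffs_sum coeffs_smul coeffs_gen ext_basis_def) (intro sum.cong refl, auto)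
  qed
  then interpret unitary_coframe \<theta> .
  have diag: "u = diag l'" if u11: "\<And>I J. coeffs u I J \<noteq> 0 \<Longrightarrow> card I = 1 \<and> card J = 1"
    and eu: "\<And>p q :: 'n. herm (\<lambda>i j. coeffs u {i} {j} / \<i>) (e p) (e q) = (if p = q then of_real (l' p) else 0)" for u l'
  proof -
    have "u = (\<Sum>i\<in>UNIV. \<Sum>j\<in>UNIV. coeffs u {i} {j} *\<^sub>c (gen True i * gen False j))"
      by (rule alt_11_expansion[OF u11])
    also have "\<dots> = (\<Sum>i\<in>UNIV. \<Sum>j\<in>UNIV. coeffs u {i} {j} *\<^sub>c (\<Sum>p\<in>UNIV. \<Sum>q\<in>UNIV. (e p $ i * cnj (e q $ j)) *\<^sub>c (\<theta> True p * \<theta> False q)))"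
      by (simp only: gen[of True] gen[of False] E_def if_True if_False smul_sum_product)
    also have "\<dots> = (\<Sum>p\<in>UNIV. \<Sum>q\<in>UNIV. \<Sum>i\<in>UNIV. \<Sum>j\<in>UNIV. (coeffs u {i} {j} * (e p $ i * cnj (e q $ j))) *\<^sub>c (\<theta> True p * \<theta> False q))"
      by (simp only: smul_sum(1) smul_simps(1)) (rule sum_swap4)
    also have "\<dots> = (\<Sum>p\<in>UNIV. \<Sum>q\<in>UNIV. (\<i> * herm (\<lambda>i j. coeffs u {i} {j} / \<i>) (e p) (e q)) *\<^sub>c (\<theta> True p * \<theta> False q))"
      by (simp add: herm_def sum_distrib_left mult_ac flip: smul_sum(2))
    also have "\<dots> = (\<Sum>p\<in>UNIV. \<Sum>q\<in>UNIV. if q = p then complex_of_real (l' p) *\<^sub>c area p else 0)"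
      unfolding eu by (intro sum.cong refl) (auto simp: area_def mult_ac)
    finally show ?thesis by (simp add: diag_def)
  qed
  have bound: "cmod (E s p j) \<le> 1 / sqrt c" for s p j
  proof -
    have "c * (norm (e p))\<^sup>2 \<le> 1" using c(2)[of "e p"] eg[of p p] by simp
    then have "(norm (e p))\<^sup>2 \<le> (1 / sqrt c)\<^sup>2" using c(1) by (simp add: field_simps power_divide)
    then have "norm (e p) \<le> 1 / sqrt c" by (rule power2_le_imp_le) (use c in auto)
    moreover have "cmod (E s p j) \<le> norm (e p)" by (simp add: E_def Finite_Cartesian_Product.norm_nth_le)
    ultimately show ?thesis by simp
  qed
  show ?thesis
  proof (rule that[OF cofr _ _ gen bound])
    show "w = diag (\<lambda>_. 1)" by (rule diag, rule w11, assumption, simp only: eg of_real_1)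
    show "y = diag l" by (rule diag, rule y11, assumption, simp only: eh)
  qed (simp add: E_def)
qed

context unitary_coframe
begin

lemma dens_top_real:
  obtains r where "0 \<le> r" "dens (vol UNIV) = complex_of_real r"
    "\<And>l a b. a + b = CARD('n) \<Longrightarrow> dens (mixed l a b) = complex_of_real (fact a * fact b * esym l UNIV a * r)"
proof -
  obtain r where r: "0 \<le> r" "dens (vol UNIV) = complex_of_real r" using dens_vol by blast
  then have "dens (mixed l a b) = complex_of_real (fact a * fact b * esym l UNIV a * r)" if "a + b = CARD('n)" for l a b
    by (simp add: mixed_top[OF that])
  with r that show ?thesis by blast
qed

text \<open>With \<open>u = \<partial>h\<close> and \<open>v\<close> its conjugate, \<open>dh \<and> d\<^sup>ch = (u + v) \<and> \<i> (v - u) = 2 \<i> u \<and> v\<close>, and only the diagonal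
terms \<open>\<theta>\<^sub>p \<and> \<theta>\<^sub>p*\<close> of \<open>u \<and> v\<close> survive.\<close>

lemma dens_dh_dch:
  fixes b :: "'n \<Rightarrow> complex"
  defines "u \<equiv> \<Sum>p\<in>UNIV. b p *\<^sub>c \<theta> True p" and "v \<equiv> \<Sum>p\<in>UNIV. cnj (b p) *\<^sub>c \<theta> False p"
  assumes n: "a + k = CARD('n) - 1"
  shows "dens ((u + v) * (\<i> *\<^sub>c (v - u)) * mixed l a k)
      = 2 * fact a * fact k * dens (vol UNIV) * complex_of_real (\<Sum>p\<in>UNIV. (cmod (b p))\<^sup>2 * esym l (- {p}) a)"
proof -
  have uv: "u * v = - (v * u)"
  proof -
    have "u * v = - (\<Sum>p\<in>UNIV. \<Sum>q\<in>UNIV. (b p * cnj (b q)) *\<^sub>c (\<theta> False q * \<theta> True p))"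
      unfolding u_def v_def smul_sum_product sum_negf[symmetric]
      by (intro sum.cong refl, subst anti) (simp add: smul_distribs)
    also have "\<dots> = - (v * u)"
      unfolding u_def v_def smul_sum_product by (subst sum.swap) (simp only: mult.commute)
    finally show ?thesis .
  qed
  have sq: "u * u = 0" "v * v = 0"
  proof -
    have "u * u = - (\<Sum>p\<in>UNIV. \<Sum>q\<in>UNIV. (b p * b q) *\<^sub>c (\<theta> True q * \<theta> True p))"
      unfolding u_def smul_sum_product sum_negf[symmetric]
      by (intro sum.cong refl, subst anti) (simp add: smul_distribs)
    also have "\<dots> = - (u * u)"
      unfolding u_def smul_sum_product by (subst sum.swap) (simp only: mult.commute)
    finally show "u * u = 0" by (rule eq_uminus_alt)
    have "v * v = - (\<Sum>p\<in>UNIV. \<Sum>q\<in>UNIV. (cnj (b p) * cnj (b q)) *\<^sub>c (\<theta> False q * \<theta> False p))"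
      unfolding v_def smul_sum_product sum_negf[symmetric]
      by (intro sum.cong refl, subst anti) (simp add: smul_distribs)
    also have "\<dots> = - (v * v)"
      unfolding v_def smul_sum_product by (subst sum.swap) (simp only: mult.commute)
    finally show "v * v = 0" by (rule eq_uminus_alt)
  qed
  have "(u + v) * (\<i> *\<^sub>c (v - u)) = \<i> *\<^sub>c (u * v - v * u)"
    using sq by (simp add: algebra_simps)
  also have "v * u = - (u * v)" using uv by simp
  also have "\<i> *\<^sub>c (u * v - - (u * v)) = (2 * \<i>) *\<^sub>c (u * v)"
    by (simp add: smul_distribs flip: smul_distribs(2))
  finally have "(u + v) * (\<i> *\<^sub>c (v - u)) * mixed l a k = (2 * \<i>) *\<^sub>c (u * v * mixed l a k)"
    by (simp only: smul_mult)
  also have "u * v * mixed l a k = (\<Sum>p\<in>UNIV. \<Sum>q\<in>UNIV. (b p * cnj (b q)) *\<^sub>c (\<theta> True p * \<theta> False q * mixed l a k))"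
    unfolding u_def v_def smul_sum_product by (simp add: sum_distrib_right)
  also have "(\<Sum>p\<in>UNIV. \<Sum>q\<in>UNIV. (b p * cnj (b q)) *\<^sub>c (\<theta> True p * \<theta> False q * mixed l a k))
     = (\<Sum>p\<in>UNIV. \<Sum>q\<in>UNIV. if q = p then (b p * cnj (b p) * (- \<i> * complex_of_real (fact a * fact k * esym l (- {p}) a))) *\<^sub>c vol UNIV else 0)"
    by (intro sum.cong refl) (simp add: theta_theta_mixed[OF n])
  also have "\<dots> = (\<Sum>p\<in>UNIV. (complex_of_real ((cmod (b p))\<^sup>2) * (- \<i> * complex_of_real (fact a * fact k * esym l (- {p}) a))) *\<^sub>c vol UNIV)"
    by (simp only: complex_norm_square[symmetric]) simp
  finally show ?thesis
    by (simp add: sum_distrib_left mult_ac sum_negf)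
qed

text \<open>The factor \<open>n\<^sup>3 K\<^sup>3\<close> accounts for expanding three generators in the coframe.\<close>

lemma dens_theta_prod_bound:
  assumes E: "\<And>s j. gen s j = (\<Sum>p\<in>UNIV. E s p j *\<^sub>c \<theta> s p)" "\<And>s p j. cmod (E s p j) \<le> K"
    and n: "a + b = CARD('n) - 2" "2 \<le> CARD('n)"
  shows "cmod (dens (\<theta> s p * (gen t1 j1 * (gen t2 j2 * gen t3 j3)) * mixed l a b))
    \<le> (real CARD('n)) ^ 3 * K ^ 3 * (fact a * fact b * cmod (dens (vol UNIV)) * (\<Sum>q\<in>- {p}. \<bar>esym l (- {p, q}) a\<bar>))"
    (is "_ \<le> _ * ?B")
proof -
  have K: "0 \<le> K" using E(2)[of True undefined undefined] norm_ge_zero order_trans by blast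
  then have K3: "0 \<le> K * (K * K)" by simp
  have B: "0 \<le> ?B" by (intro mult_nonneg_nonneg sum_nonneg) auto
  have "\<theta> s p * (gen t1 j1 * (gen t2 j2 * gen t3 j3)) * mixed l a b = (\<Sum>q3\<in>UNIV. \<Sum>q2\<in>UNIV. \<Sum>q1\<in>UNIV.
      (E t3 q3 j3 * (E t2 q2 j2 * E t1 q1 j1)) *\<^sub>c (\<theta> s p * (\<theta> t1 q1 * (\<theta> t2 q2 * \<theta> t3 q3)) * mixed l a b))"
    unfolding E(1) by (simp add: sum_distrib_left sum_distrib_right smul_sum(1) mult_ac)
  then have "dens (\<theta> s p * (gen t1 j1 * (gen t2 j2 * gen t3 j3)) * mixed l a b) = (\<Sum>q3\<in>UNIV. \<Sum>q2\<in>UNIV. \<Sum>q1\<in>UNIV.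
      (E t3 q3 j3 * (E t2 q2 j2 * E t1 q1 j1)) * dens (\<theta> s p * (\<theta> t1 q1 * (\<theta> t2 q2 * \<theta> t3 q3)) * mixed l a b))"
    by simp
  then have "cmod (dens (\<theta> s p * (gen t1 j1 * (gen t2 j2 * gen t3 j3)) * mixed l a b))
    \<le> (\<Sum>q3\<in>(UNIV::'n set). \<Sum>q2\<in>(UNIV::'n set). \<Sum>q1\<in>(UNIV::'n set). (K * (K * K)) * ?B)"
    unfolding dens_simps
    by (simp only:) (intro sum_norm_le, auto simp: norm_mult intro!: mult_mono E(2) theta4_mixed_bound[OF n] K K3 B)
  also have "\<dots> = (real CARD('n)) ^ 3 * K ^ 3 * ?B"
    by (simp add: power3_eq_cube mult_ac)
  finally show ?thesis .
qed

end

section \<open>The pointwise inequality in the exterior algebra\<close>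

text \<open>Here \<open>w\<close>, \<open>y\<close> and \<open>\<eta>\<close> are the values of \<open>\<omega>\<close>, \<open>\<gamma>\<close> and \<open>d\<^sup>c\<omega>\<close> at a point, and \<open>\<alpha> + \<beta>\<close> is \<open>dh\<close> split into
types.  Expanding \<open>\<alpha> + \<beta>\<close> in the coframe bounds the left-hand side by a multiple of
\<open>\<Sum> |b\<^sub>p| (S\<^sub>p e)\<^bsup>1/2\<^esup>\<close> with \<open>S\<^sub>p = e\<^bsub>m-1\<^esub>(\<lambda>|p)\<close> and \<open>e = e\<^bsub>m-1\<^esub>(\<lambda>)\<close>, and Cauchy--Schwarz for this sum finishes the
proof.\<close>

lemma pointwise_inequality:
  fixes w y :: "'n::{finite,linorder} alt" and a :: "'n \<Rightarrow> complex" and u :: "bool \<Rightarrow> 'n \<Rightarrow> 'n \<Rightarrow> 'n \<Rightarrow> complex"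
  assumes w11: "\<And>I J. coeffs w I J \<noteq> 0 \<Longrightarrow> card I = 1 \<and> card J = 1"
    and y11: "\<And>I J. coeffs y I J \<noteq> 0 \<Longrightarrow> card I = 1 \<and> card J = 1"
    and wreal: "ext_cnj (coeffs w) = coeffs w" and yreal: "ext_cnj (coeffs y) = coeffs y"
    and c: "0 < c" "\<And>v. c * (norm v)\<^sup>2 \<le> Re (herm (\<lambda>i j. coeffs w {i} {j} / \<i>) v v)"
    and M: "\<And>t i j k. cmod (u t i j k) \<le> M"
    and m: "1 \<le> m" "m \<le> CARD('n) - 1"
    and pos: "\<And>k. 1 \<le> k \<Longrightarrow> k \<le> m \<Longrightarrow> 0 < Re (dens (y ^ k * w ^ (CARD('n) - k)))"
  defines "\<alpha> \<equiv> \<Sum>j\<in>UNIV. a j *\<^sub>c gen True j" and "\<beta> \<equiv> \<Sum>j\<in>UNIV. cnj (a j) *\<^sub>c gen False j"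
    and "\<eta> \<equiv> \<Sum>t\<in>UNIV. \<Sum>i\<in>UNIV. \<Sum>j\<in>UNIV. \<Sum>k\<in>UNIV. u t i j k *\<^sub>c (gen t i * (gen True j * gen False k))"
  shows "\<exists>A B. 0 \<le> A \<and> 0 \<le> B \<and>
    dens ((\<alpha> + \<beta>) * (\<i> *\<^sub>c (\<beta> - \<alpha>) * (y ^ (m - 1) * w ^ (CARD('n) - m)))) = complex_of_real A \<and>
    dens (y ^ (m - 1) * w ^ (CARD('n) - m + 1)) = complex_of_real B \<and>
    (cmod (dens ((\<alpha> + \<beta>) * (\<eta> * (y ^ (m - 1) * w ^ (CARD('n) - m - 1))))))\<^sup>2
      \<le> 16 * real CARD('n) ^ 17 * M\<^sup>2 / c ^ 3 * (A * B)"
proof -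
  obtain \<theta> l E where cofr: "unitary_coframe \<theta>" and
    wd: "w = coframe.diag \<theta> (\<lambda>_. 1)" and yd: "y = coframe.diag \<theta> l" and
    gen: "\<And>s j. gen s j = (\<Sum>p\<in>UNIV. E s p j *\<^sub>c \<theta> s p)" and
    E: "\<And>s p j. cmod (E s p j) \<le> 1 / sqrt c" and Ecnj: "\<And>p j. E False p j = cnj (E True p j)"
    by (rule unitary_coframe_exists[OF w11 y11 wreal yreal c]) blast+
  interpret unitary_coframe \<theta> by (rule cofr)
  have mixed: "y ^ i * w ^ j = mixed l i j" for i j by (simp add: mixed_def wd yd)
  define n where "n = CARD('n)"
  have n: "2 \<le> n" using m by (simp add: n_def)
  define K where "K = 1 / sqrt c"
  have K: "0 \<le> K" "K ^ 6 = 1 / c ^ 3"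
  proof -
    have "sqrt c ^ 6 = (sqrt c ^ 2) ^ 3" by (simp flip: power_mult)
    then show "0 \<le> K" "K ^ 6 = 1 / c ^ 3" using c(1) by (simp_all add: K_def power_divide)
  qed
  obtain r where r: "0 \<le> r" "dens (vol UNIV) = complex_of_real r"
    "\<And>l a b. a + b = CARD('n) \<Longrightarrow> dens (mixed l a b) = complex_of_real (fact a * fact b * esym l UNIV a * r)"
    by (rule dens_top_real) blast+
  have pos': "0 < esym l UNIV k * r" if "1 \<le> k" "k \<le> m" for k
  proof -
    have "0 < (fact k * fact (CARD('n) - k)) * (esym l UNIV k * r)"
      using pos[OF that] r(3)[of k "CARD('n) - k" l] that m by (simp add: mixed mult.assoc)
    then show ?thesis by (rule zero_less_mult_pos) simp
  qed
  \<comment> \<open>The density \<open>r\<close> of the volume element is nonzero, because the positive density of \<open>\<gamma> \<and> \<omega>\<^bsup>n-1\<^esup>\<close> is a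
    multiple of it.\<close>
  have "0 < r" using pos'[of 1] r(1) m by (auto simp: zero_less_mult_iff)
  then have epos: "0 < esym l UNIV k" if "k \<le> Suc (m - 1)" for k
    using that m pos'[of k] by (cases "k = 0") (auto simp: zero_less_mult_iff)
  define b where "b p = (\<Sum>j\<in>UNIV. a j * E True p j)" for p
  have \<alpha>: "\<alpha> = (\<Sum>p\<in>UNIV. b p *\<^sub>c \<theta> True p)"
    unfolding \<alpha>_def b_def gen smul_sum smul_simps by (rule sum.swap)
  have \<beta>: "\<beta> = (\<Sum>p\<in>UNIV. cnj (b p) *\<^sub>c \<theta> False p)"
    unfolding \<beta>_def b_def gen smul_sum smul_simps cnj_sum complex_cnj_mult Ecnj by (rule sum.swap)
  define a0 k1 where "a0 = m - 1" and "k1 = CARD('n) - m - 1"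
  define S where "S p = esym l (- {p}) a0" for p
  define Ee where "Ee = esym l UNIV a0"
  define Q where "Q = (\<Sum>p\<in>UNIV. (cmod (b p))\<^sup>2 * S p)"
  have S: "0 < S p" for p
    using esym_remove_pos[of UNIV p "Suc (m - 1)" l a0] epos by (simp add: S_def a0_def Compl_eq_Diff_UNIV)
  have Ee: "0 < Ee" using epos by (simp add: Ee_def a0_def)
  have Q: "0 \<le> Q" using S by (auto simp: Q_def less_imp_le intro!: sum_nonneg)
  define A where "A = 2 * fact a0 * fact (CARD('n) - m) * r * Q"
  define B where "B = fact a0 * fact (CARD('n) - m + 1) * Ee * r"
  have AB: "0 \<le> A" "0 \<le> B" using r(1) Q Ee by (auto simp: A_def B_def)
  have dA: "dens ((\<alpha> + \<beta>) * (\<i> *\<^sub>c (\<beta> - \<alpha>) * (y ^ (m - 1) * w ^ (CARD('n) - m)))) = complex_of_real A"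
    using dens_dh_dch[of a0 "CARD('n) - m" b l] m
    by (simp add: \<alpha> \<beta> mixed A_def Q_def S_def r(2) a0_def mult.assoc)
  have dB: "dens (y ^ (m - 1) * w ^ (CARD('n) - m + 1)) = complex_of_real B"
    unfolding mixed B_def Ee_def a0_def by (rule r(3)) (use m in simp)
  define f where "f = fact a0 * fact k1 * r"
  have f: "0 \<le> f" using r(1) by (simp add: f_def)
  define T where "T p = (\<Sum>q\<in>- {p}. \<bar>esym l (- {p, q}) a0\<bar>)" for p
  have T0: "0 \<le> T p" for p by (simp add: T_def sum_nonneg)
  have T: "T p \<le> real n ^ 2 * (sqrt (S p) * sqrt Ee)" for p
  proof -
    have "\<bar>esym l (- {p, q}) a0\<bar> \<le> real n * (sqrt (S p) * sqrt Ee)" if "q \<in> - {p}" for q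
    proof -
      have "(esym l (- {p, q}) a0)\<^sup>2 \<le> (real n)\<^sup>2 * (S p * Ee)"
        using esym_remove_two_bound[of UNIV p q a0 l] epos that
        by (auto simp: S_def Ee_def a0_def n_def Compl_eq_Diff_UNIV)
      then have "sqrt ((esym l (- {p, q}) a0)\<^sup>2) \<le> sqrt ((real n)\<^sup>2 * (S p * Ee))" by (rule real_sqrt_le_mono)
      then show ?thesis by (simp add: real_sqrt_mult)
    qed
    then have "T p \<le> (\<Sum>q\<in>- {p}. real n * (sqrt (S p) * sqrt Ee))" unfolding T_def by (rule sum_mono)
    also have "\<dots> = real (card (- {p})) * (real n * (sqrt (S p) * sqrt Ee))" by simp
    also have "\<dots> \<le> real n * (real n * (sqrt (S p) * sqrt Ee))"
      using S[of p] Ee by (intro mult_right_mono) (auto simp: n_def card_mono)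
    finally show ?thesis by (simp add: power2_eq_square)
  qed
  define P where "P = mixed l a0 k1"
  \<comment> \<open>\<open>2 n\<^sup>3\<close> terms of \<open>\<eta>\<close>, each of size \<open>M\<close>, times the factor \<open>n\<^sup>3 K\<^sup>3 f\<close> from the expansion of a term\<close>
  define Z where "Z = 2 * real n ^ 6 * M * K ^ 3 * f"
  have M0: "0 \<le> M" using M[of True undefined undefined undefined] norm_ge_zero order_trans by blast
  have Z0: "0 \<le> Z" using M0 K f by (simp add: Z_def)
  have tri: "cmod (dens (\<theta> s p * (gen t1 j1 * (gen t2 j2 * gen t3 j3)) * P)) \<le> real n ^ 3 * K ^ 3 * (f * T p)"
    for s p t1 j1 t2 j2 t3 j3
    using dens_theta_prod_bound[OF gen E, of a0 k1 s p t1 j1 t2 j2 t3 j3 l] m r(1)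
    by (simp add: P_def K_def n_def T_def f_def r(2) a0_def k1_def)
  have eta: "cmod (dens (\<theta> s p * \<eta> * P)) \<le> Z * T p" for s p
  proof -
    have "dens (\<theta> s p * \<eta> * P) = (\<Sum>t\<in>UNIV. \<Sum>i\<in>UNIV. \<Sum>j\<in>UNIV. \<Sum>k\<in>UNIV.
        u t i j k * dens (\<theta> s p * (gen t i * (gen True j * gen False k)) * P))"
      unfolding \<eta>_def by (simp add: sum_distrib_left sum_distrib_right)
    also have "cmod \<dots> \<le> (\<Sum>t\<in>(UNIV::bool set). \<Sum>i\<in>(UNIV::'n set). \<Sum>j\<in>(UNIV::'n set). \<Sum>k\<in>(UNIV::'n set).
        M * (real n ^ 3 * K ^ 3 * (f * T p)))"
      by (intro sum_norm_le, unfold norm_mult) (intro mult_mono M tri norm_ge_zero M0)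
    also have "\<dots> = Z * T p"
      by (simp add: Z_def n_def power_numeral_reduce)
    finally show ?thesis .
  qed
  have "dens ((\<alpha> + \<beta>) * (\<eta> * P)) = (\<Sum>p\<in>UNIV. b p * dens (\<theta> True p * \<eta> * P) + cnj (b p) * dens (\<theta> False p * \<eta> * P))"
    unfolding \<alpha> \<beta> by (simp add: sum.distrib sum_distrib_right distrib_right mult.assoc)
  also have "cmod \<dots> \<le> (\<Sum>p\<in>UNIV. 2 * (cmod (b p) * (Z * (real n ^ 2 * (sqrt (S p) * sqrt Ee)))))"
  proof (rule sum_norm_le)
    fix p
    have "cmod (b p * dens (\<theta> True p * \<eta> * P) + cnj (b p) * dens (\<theta> False p * \<eta> * P))
       \<le> cmod (b p) * (Z * T p) + cmod (b p) * (Z * T p)"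
      using eta[of True p] eta[of False p]
      by (intro norm_triangle_mono) (auto simp: norm_mult intro!: mult_left_mono)
    also have "\<dots> = 2 * (cmod (b p) * (Z * T p))" by simp
    also have "\<dots> \<le> 2 * (cmod (b p) * (Z * (real n ^ 2 * (sqrt (S p) * sqrt Ee))))"
      using T[of p] Z0 by (intro mult_left_mono) auto
    finally show "cmod (b p * dens (\<theta> True p * \<eta> * P) + cnj (b p) * dens (\<theta> False p * \<eta> * P)) \<le> \<dots>" .
  qed
  also have "\<dots> = 2 * Z * real n ^ 2 * sqrt Ee * (\<Sum>p\<in>UNIV. cmod (b p) * sqrt (S p))"
    by (simp add: sum_distrib_left mult_ac)
  finally have "(cmod (dens ((\<alpha> + \<beta>) * (\<eta> * P))))\<^sup>2
      \<le> (2 * Z * real n ^ 2 * sqrt Ee * (\<Sum>p\<in>UNIV. cmod (b p) * sqrt (S p)))\<^sup>2"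
    by (rule power_mono) simp
  also have "\<dots> = 4 * Z\<^sup>2 * real n ^ 4 * Ee * (\<Sum>p\<in>UNIV. cmod (b p) * sqrt (S p))\<^sup>2"
    using Ee by (simp add: power_mult_distrib flip: power_mult)
  also have "\<dots> \<le> 4 * Z\<^sup>2 * real n ^ 4 * Ee * (real n * Q)"
  proof (rule mult_left_mono)
    have "(\<Sum>p\<in>UNIV. 1 * (cmod (b p) * sqrt (S p)))\<^sup>2 \<le> (\<Sum>p\<in>(UNIV :: 'n set). 1\<^sup>2) * (\<Sum>p\<in>UNIV. (cmod (b p) * sqrt (S p))\<^sup>2)"
      by (rule Cauchy_Schwarz_ineq_sum)
    also have "(\<Sum>p\<in>UNIV. (cmod (b p) * sqrt (S p))\<^sup>2) = Q"
      using S by (simp add: Q_def power_mult_distrib less_imp_le)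
    finally show "(\<Sum>p\<in>UNIV. cmod (b p) * sqrt (S p))\<^sup>2 \<le> real n * Q" by (simp add: n_def)
  qed (use Ee in simp)
  also have "\<dots> = 16 * real n ^ 17 * M\<^sup>2 * K ^ 6 * (f\<^sup>2 * (Q * Ee))"
    by (simp add: Z_def power_mult_distrib power_numeral_reduce mult_ac)
  also have "\<dots> = 16 * real n ^ 17 * M\<^sup>2 / c ^ 3 * (f\<^sup>2 * (Q * Ee))"
    by (simp add: K(2))
  also have "\<dots> \<le> 16 * real n ^ 17 * M\<^sup>2 / c ^ 3 * (A * B)"
  proof (rule mult_left_mono)
    have le: "fact k1 \<le> (fact (CARD('n) - m) :: real)" "fact k1 \<le> (fact (CARD('n) - m + 1) :: real)"
      unfolding k1_def by (intro fact_mono; simp)+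
    have "fact k1 * fact k1 \<le> (2 * fact (CARD('n) - m)) * (fact (CARD('n) - m + 1) :: real)"
      by (intro mult_mono le) (use le in \<open>auto intro: order_trans\<close>)
    then have "(fact a0 * r)\<^sup>2 * (Q * Ee) * (fact k1 * fact k1)
       \<le> (fact a0 * r)\<^sup>2 * (Q * Ee) * ((2 * fact (CARD('n) - m)) * fact (CARD('n) - m + 1))"
      using Q Ee by (intro mult_left_mono) auto
    then show "f\<^sup>2 * (Q * Ee) \<le> A * B"
      by (simp add: f_def A_def B_def power2_eq_square mult_ac)
  qed (use c in simp)
  finally have "(cmod (dens ((\<alpha> + \<beta>) * (\<eta> * P))))\<^sup>2 \<le> 16 * real n ^ 17 * M\<^sup>2 / c ^ 3 * (A * B)" .
  then show ?thesis
    using AB dA dB by (intro exI[of _ A] exI[of _ B]) (simp add: P_def mixed n_def a0_def k1_def)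
qed

section \<open>Smooth forms\<close>

lemma smooth_on_imp_continuous_on: "smooth_on S f \<Longrightarrow> continuous_on S f"
  unfolding smooth_on_def by (metis Ck_on.simps(1))

lemma smooth_on_imp_C1:
  assumes "smooth_on S f"
  shows "x \<in> S \<Longrightarrow> f differentiable (at x)" "continuous_on S (\<lambda>x. frechet_derivative f (at x) v)"
proof -
  have "Ck_on (Suc 0) S f" using assms unfolding smooth_on_def by blast
  then show "x \<in> S \<Longrightarrow> f differentiable (at x)" "continuous_on S (\<lambda>x. frechet_derivative f (at x) v)"
    by auto
qed

lemma frechet_derivative_of_real_mult:
  fixes h :: "'a::real_normed_vector \<Rightarrow> real"
  assumes "h differentiable (at x)"
  shows "frechet_derivative (\<lambda>x. complex_of_real (h x) * c) (at x) v = complex_of_real (frechet_derivative h (at x) v) * c"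
proof -
  have "(h has_derivative frechet_derivative h (at x)) (at x)"
    using assms frechet_derivative_works by blast
  then have "((\<lambda>x. complex_of_real (h x) * c) has_derivative (\<lambda>v. complex_of_real (frechet_derivative h (at x) v) * c)) (at x)"
    by (intro derivative_eq_intros has_derivative_of_real) auto
  then show ?thesis using frechet_derivative_at by metis
qed

lemma wirt_zero: "wirt j (\<lambda>w. 0) z = 0" "wirt_bar j (\<lambda>w. 0) z = 0"
  by (simp_all add: wirt_def wirt_bar_def)

lemma wirt_bar_real:
  assumes "h differentiable (at z)"
  shows "wirt_bar j (\<lambda>w. complex_of_real (h w)) z = cnj (wirt j (\<lambda>w. complex_of_real (h w)) z)"
  using frechet_derivative_of_real_mult[OF assms, of 1] by (simp add: wirt_def wirt_bar_def)

lemma cmod_wirt_le: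
  "cmod (wirt j f z) \<le> cmod (frechet_derivative f (at z) (axis j 1)) + cmod (frechet_derivative f (at z) (axis j \<i>))"
  "cmod (wirt_bar j f z) \<le> cmod (frechet_derivative f (at z) (axis j 1)) + cmod (frechet_derivative f (at z) (axis j \<i>))"
proof -
  let ?a = "frechet_derivative f (at z) (axis j 1)" and ?b = "frechet_derivative f (at z) (axis j \<i>)"
  have "cmod (?a - \<i> * ?b) \<le> cmod ?a + cmod ?b" "cmod (?a + \<i> * ?b) \<le> cmod ?a + cmod ?b"
    using norm_triangle_ineq4[of ?a "\<i> * ?b"] norm_triangle_ineq[of ?a "\<i> * ?b"] by (simp_all add: norm_mult)
  then show "cmod (wirt j f z) \<le> cmod ?a + cmod ?b" "cmod (wirt_bar j f z) \<le> cmod ?a + cmod ?b"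
    unfolding wirt_def wirt_bar_def norm_divide
    by (simp_all add: add_nonneg_nonneg) (smt (verit) norm_ge_zero)+
qed

subsection \<open>Forms at a point as elements of the ring\<close>

lemma Alt_wedge: "Alt ((\<alpha> \<and>\<^sub>F \<beta>) z) = Alt (\<alpha> z) * Alt (\<beta> z)"
  by (simp add: form_wedge_def times_alt_def Alt_inverse)

lemma Alt_pow: "Alt ((\<alpha> ^\<^sub>F k) z) = Alt (\<alpha> z) ^ k"
  by (induction k) (simp_all add: one_alt_def Alt_wedge)

lemma Alt_sum: "Alt (\<lambda>I J. \<Sum>j\<in>S. f j I J) = (\<Sum>j\<in>S. Alt (f j))"
  by (rule alt_eqI) (simp add: coeffs_sum Alt_inverse)

lemma ext_density_dens: "ext_density a = dens (Alt a)"
  by (simp add: dens_def Alt_inverse)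

lemma Alt_del:
  "Alt (form_del \<alpha> z) = (\<Sum>j\<in>UNIV. gen True j * Alt (\<lambda>K L. wirt j (\<lambda>w. \<alpha> w K L) z))"
  by (simp add: form_del_def Alt_sum gen_def times_alt_def Alt_inverse)

lemma Alt_delbar:
  "Alt (form_delbar \<alpha> z) = (\<Sum>j\<in>UNIV. gen False j * Alt (\<lambda>K L. wirt_bar j (\<lambda>w. \<alpha> w K L) z))"
  by (simp add: form_delbar_def Alt_sum gen_def times_alt_def Alt_inverse)

lemma Alt_d: "Alt (form_d \<alpha> z) = Alt (form_del \<alpha> z) + Alt (form_delbar \<alpha> z)"
  by (simp add: form_d_def plus_alt_def Alt_inverse)

lemma Alt_dc: "Alt (form_dc \<alpha> z) = \<i> *\<^sub>c (Alt (form_delbar \<alpha> z) - Alt (form_del \<alpha> z))"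
  by (simp add: form_dc_def smul_def minus_alt_def Alt_inverse)

text \<open>The coefficients of \<open>h\<close> as a form are either \<open>h\<close> itself or the zero function, whose derivatives vanish.\<close>

lemma Alt_del_real_fun:
  "Alt (form_del (form_of_real_fun h) z) = (\<Sum>j\<in>UNIV. wirt j (\<lambda>w. complex_of_real (h w)) z *\<^sub>c gen True j)"
proof -
  have "Alt (\<lambda>K L. wirt j (\<lambda>w. form_of_real_fun h w K L) z) = wirt j (\<lambda>w. complex_of_real (h w)) z *\<^sub>c (1 :: 'a alt)" for j
    by (rule alt_eqI) (simp add: Alt_inverse coeffs_smul coeffs_simps form_of_real_fun_def ext_one_def wirt_zero)
  then show ?thesis by (simp add: Alt_del)
qed

lemma Alt_delbar_real_fun:
  assumes "h differentiable (at z)"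
  shows "Alt (form_delbar (form_of_real_fun h) z) = (\<Sum>j\<in>UNIV. cnj (wirt j (\<lambda>w. complex_of_real (h w)) z) *\<^sub>c gen False j)"
proof -
  have "Alt (\<lambda>K L. wirt_bar j (\<lambda>w. form_of_real_fun h w K L) z) = cnj (wirt j (\<lambda>w. complex_of_real (h w)) z) *\<^sub>c (1 :: 'a alt)" for j
    by (rule alt_eqI)
       (simp add: Alt_inverse coeffs_smul coeffs_simps form_of_real_fun_def ext_one_def wirt_zero wirt_bar_real[OF assms])
  then show ?thesis by (simp add: Alt_delbar)
qed

subsection \<open>Continuity of the coefficients\<close>

definition continuous_form_on :: "(complex ^ 'n::finite) set \<Rightarrow> 'n form \<Rightarrow> bool" where
  "continuous_form_on S \<alpha> \<longleftrightarrow> (\<forall>I J. continuous_on S (\<lambda>z. \<alpha> z I J))"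

lemma continuous_on_ext_wedge:
  assumes "\<And>I J. continuous_on S (\<lambda>z. a z I J)" "\<And>I J. continuous_on S (\<lambda>z. b z I J)"
  shows "continuous_on S (\<lambda>z. ext_wedge (a z) (b z) I J)"
  unfolding ext_wedge_def by (intro continuous_intros assms)

lemma continuous_form_on_wedge:
  "continuous_form_on S \<alpha> \<Longrightarrow> continuous_form_on S \<beta> \<Longrightarrow> continuous_form_on S (\<alpha> \<and>\<^sub>F \<beta>)"
  unfolding continuous_form_on_def form_wedge_def by (blast intro: continuous_on_ext_wedge)

lemma continuous_form_on_pow: "continuous_form_on S \<alpha> \<Longrightarrow> continuous_form_on S (\<alpha> ^\<^sub>F k)"
proof (induction k)
  case 0
  show ?case by (simp add: continuous_form_on_def)
next
  case (Suc k)
  then show ?case by (simp add: continuous_form_on_wedge)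
qed

lemma continuous_form_on_smooth: "smooth_form_on S \<alpha> \<Longrightarrow> continuous_form_on S \<alpha>"
  by (auto simp: smooth_form_on_def continuous_form_on_def intro: smooth_on_imp_continuous_on)

lemma continuous_form_on_subset: "continuous_form_on S \<alpha> \<Longrightarrow> T \<subseteq> S \<Longrightarrow> continuous_form_on T \<alpha>"
  by (auto simp: continuous_form_on_def intro: continuous_on_subset)

lemma continuous_form_on_d_dc:
  assumes "\<And>K L v. continuous_on S (\<lambda>z. frechet_derivative (\<lambda>w. \<alpha> w K L) (at z) v)"
  shows "continuous_form_on S (form_d \<alpha>)" "continuous_form_on S (form_dc \<alpha>)"
proof -
  have *: "continuous_on S (\<lambda>z. form_del \<alpha> z I J)" "continuous_on S (\<lambda>z. form_delbar \<alpha> z I J)" for I J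
    unfolding form_del_def form_delbar_def wirt_def wirt_bar_def
    by (intro continuous_intros continuous_on_ext_wedge assms; simp)+
  show "continuous_form_on S (form_d \<alpha>)" "continuous_form_on S (form_dc \<alpha>)"
    unfolding continuous_form_on_def form_d_def form_dc_def by (intro allI continuous_intros *)+
qed

lemma continuous_form_on_d_dc_smooth:
  assumes "smooth_form_on S \<alpha>"
  shows "continuous_form_on S (form_d \<alpha>)" "continuous_form_on S (form_dc \<alpha>)"
  using assms by (auto intro!: continuous_form_on_d_dc smooth_on_imp_C1(2) simp: smooth_form_on_def)

lemma continuous_form_on_d_dc_real_fun:
  fixes h :: "complex ^ 'n::{finite,linorder} \<Rightarrow> real"
  assumes "smooth_on S h"
  shows "continuous_form_on S (form_d (form_of_real_fun h))" "continuous_form_on S (form_dc (form_of_real_fun h))"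
proof -
  have "continuous_on S (\<lambda>z. complex_of_real (frechet_derivative h (at z) v) * c)" for v c
    by (intro continuous_intros smooth_on_imp_C1(2)[OF assms])
  then have "continuous_on S (\<lambda>z. frechet_derivative (\<lambda>w. complex_of_real (h w) * c) (at z) v)" for v c
    using frechet_derivative_of_real_mult[OF smooth_on_imp_C1(1)[OF assms]] by (simp cong: continuous_on_cong)
  then show "continuous_form_on S (form_d (form_of_real_fun h))" "continuous_form_on S (form_dc (form_of_real_fun h))"
    by (intro continuous_form_on_d_dc; simp add: form_of_real_fun_def)+
qed

lemma continuous_on_density: "continuous_form_on S \<alpha> \<Longrightarrow> continuous_on S (\<lambda>z. ext_density (\<alpha> z))"
  unfolding ext_density_def continuous_form_on_def by (intro continuous_intros) auto

subsection \<open>Uniform bounds for a Hermitian metric\<close>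

text \<open>By homogeneity it suffices to minimise over \<open>closure \<Omega>\<close> times the unit sphere, which is compact because
\<open>\<Omega>\<close> is bounded; the metric is defined beyond \<open>\<Omega>\<close>.\<close>

lemma hermitian_metric_lower_bound:
  fixes \<omega> :: "'n::{finite,linorder} form"
  assumes "hermitian_metric \<omega>" "bounded \<Omega>"
  obtains c where "0 < c" "\<And>z v. z \<in> \<Omega> \<Longrightarrow> c * (norm v)\<^sup>2 \<le> Re (herm (\<lambda>i j. \<omega> z {i} {j} / \<i>) v v)"
proof -
  define K where "K = closure \<Omega> \<times> sphere (0 :: (complex, 'n) vec) 1"
  have cont: "continuous_on UNIV (\<lambda>z. \<omega> z I J)" for I J
    using assms(1) by (auto simp: hermitian_metric_def smooth_form_on_def intro: smooth_on_imp_continuous_on)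
  define F where "F = (\<lambda>(z, v). Re (herm (\<lambda>i j. \<omega> z {i} {j} / \<i>) v v))"
  have F: "F (z, v) > 0" if "v \<noteq> 0" for z v
    using assms(1) that by (auto simp: F_def hermitian_metric_def herm_def)
  have "continuous_on K F"
    unfolding F_def herm_def split_beta
    by (intro continuous_intros continuous_on_compose2[OF cont]) auto
  moreover have "compact K"
    unfolding K_def using assms(2) by (intro compact_Times) (auto simp: compact_closure)
  ultimately have "\<exists>c>0. \<forall>x\<in>K. c \<le> F x"
  proof (cases "K = {}")
    case False
    assume "continuous_on K F" "compact K"
    then obtain x where x: "x \<in> K" "\<And>y. y \<in> K \<Longrightarrow> F x \<le> F y"
      using continuous_attains_inf[of K F] False by blast
    moreover have "snd x \<noteq> 0" using x(1) by (auto simp: K_def)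
    then have "F x > 0" using F[of "snd x" "fst x"] by simp
    ultimately show ?thesis by blast
  qed (auto intro: exI[of _ 1])
  then obtain c where c: "0 < c" "\<And>x. x \<in> K \<Longrightarrow> c \<le> F x" by blast
  have "c * (norm v)\<^sup>2 \<le> Re (herm (\<lambda>i j. \<omega> z {i} {j} / \<i>) v v)" if "z \<in> \<Omega>" for z v
  proof (cases "v = 0")
    case False
    define v' where "v' = complex_of_real (inverse (norm v)) *s v"
    have "v' = inverse (norm v) *\<^sub>R v"
      unfolding v'_def vec_eq_iff vector_scaleR_component vector_smult_component by (simp add: scaleR_conv_of_real)
    then have "(z, v') \<in> K" using that False closure_subset by (auto simp: K_def)
    then have "c \<le> F (z, v')" by (rule c)
    also have "F (z, v') = (inverse (norm v))\<^sup>2 * Re (herm (\<lambda>i j. \<omega> z {i} {j} / \<i>) v v)"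
      by (simp add: F_def v'_def herm_scale_left herm_scale_right power2_eq_square mult.assoc flip: of_real_inverse)
    finally show ?thesis using False by (simp add: field_simps)
  qed simp
  with c(1) that show ?thesis by blast
qed

lemma hermitian_metric_derivative_bound:
  fixes \<omega> :: "'n::{finite,linorder} form"
  assumes "hermitian_metric \<omega>" "bounded \<Omega>"
  obtains M where "0 \<le> M"
    "\<And>z i j k. z \<in> \<Omega> \<Longrightarrow> cmod (wirt i (\<lambda>w. \<omega> w {j} {k}) z) \<le> M"
    "\<And>z i j k. z \<in> \<Omega> \<Longrightarrow> cmod (wirt_bar i (\<lambda>w. \<omega> w {j} {k}) z) \<le> M"
proof -
  define G where "G i j k z = cmod (frechet_derivative (\<lambda>w. \<omega> w {j} {k}) (at z) (axis i 1))
      + cmod (frechet_derivative (\<lambda>w. \<omega> w {j} {k}) (at z) (axis i \<i>))" for i j k z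
  have "smooth_on UNIV (\<lambda>w. \<omega> w {j} {k})" for j k
    using assms(1) by (auto simp: hermitian_metric_def smooth_form_on_def)
  then have "continuous_on (closure \<Omega>) (G i j k)" for i j k
    unfolding G_def by (intro continuous_intros continuous_on_subset[OF smooth_on_imp_C1(2)[where S = UNIV]]) auto
  then have "compact (G i j k ` closure \<Omega>)" for i j k
    using assms(2) by (intro compact_continuous_image) (auto simp: compact_closure)
  then have "bounded (\<Union>i. \<Union>j. \<Union>k. G i j k ` closure \<Omega>)"
    by (intro bounded_UN ballI finite compact_imp_bounded)
  then obtain M where M: "\<forall>x\<in>(\<Union>i. \<Union>j. \<Union>k. G i j k ` closure \<Omega>). norm x \<le> M"
    unfolding bounded_iff ..
  have GM: "G i j k z \<le> \<bar>M\<bar>" if "z \<in> \<Omega>" for i j k z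
  proof -
    have "G i j k z \<in> (\<Union>i. \<Union>j. \<Union>k. G i j k ` closure \<Omega>)"
      by (rule UN_I[where a = i, OF UNIV_I], rule UN_I[where a = j, OF UNIV_I], rule UN_I[where a = k, OF UNIV_I])
        (intro imageI subsetD[OF closure_subset that])
    then have "norm (G i j k z) \<le> M" by (rule M[THEN bspec])
    then show ?thesis by simp
  qed
  show ?thesis
  proof (rule that[of "\<bar>M\<bar>"])
    fix z i j k assume "z \<in> \<Omega>"
    from GM[OF this, of i j k] show "cmod (wirt i (\<lambda>w. \<omega> w {j} {k}) z) \<le> \<bar>M\<bar>"
      "cmod (wirt_bar i (\<lambda>w. \<omega> w {j} {k}) z) \<le> \<bar>M\<bar>"
      unfolding G_def by (rule order_trans[OF cmod_wirt_le(1)], rule order_trans[OF cmod_wirt_le(2)])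
  qed simp
qed

section \<open>The pointwise inequality for forms\<close>

text \<open>One constant serves all \<open>\<gamma>\<close> and \<open>h\<close>, because it is built from \<open>n\<close>, the lower bound \<open>c\<close> of the metric and
the bound \<open>M\<close> of its first derivatives on \<open>\<Omega>\<close>.\<close>

lemma pointwise_form_inequality:
  fixes \<Omega> :: "(complex ^ 'n::{finite,linorder}) set" and \<omega> :: "'n form"
  assumes \<omega>: "hermitian_metric \<omega>" and "bounded \<Omega>" and m: "1 \<le> m" "m \<le> CARD('n) - 1"
  obtains C :: real where "0 < C"
    "\<And>\<gamma> h z. \<gamma> \<in> Gamma_cone \<Omega> \<omega> m \<Longrightarrow> smooth_on \<Omega> h \<Longrightarrow> z \<in> \<Omega> \<Longrightarrow>
      \<exists>A B. 0 \<le> A \<and> 0 \<le> B \<and>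
        ext_density ((form_d (form_of_real_fun h) \<and>\<^sub>F form_dc (form_of_real_fun h) \<and>\<^sub>F
            \<gamma> ^\<^sub>F (m - 1) \<and>\<^sub>F \<omega> ^\<^sub>F (CARD('n) - m)) z) = complex_of_real A \<and>
        ext_density ((\<gamma> ^\<^sub>F (m - 1) \<and>\<^sub>F \<omega> ^\<^sub>F (CARD('n) - m + 1)) z) = complex_of_real B \<and>
        (cmod (ext_density ((form_d (form_of_real_fun h) \<and>\<^sub>F form_dc \<omega> \<and>\<^sub>F
            \<gamma> ^\<^sub>F (m - 1) \<and>\<^sub>F \<omega> ^\<^sub>F (CARD('n) - m - 1)) z)))\<^sup>2 \<le> C * (A * B)"
proof -
  obtain c where c: "0 < c" "\<And>z v. z \<in> \<Omega> \<Longrightarrow> c * (norm v)\<^sup>2 \<le> Re (herm (\<lambda>i j. \<omega> z {i} {j} / \<i>) v v)"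
    by (rule hermitian_metric_lower_bound[OF \<omega> \<open>bounded \<Omega>\<close>]) blast+
  obtain M where M: "0 \<le> M" "\<And>z i j k. z \<in> \<Omega> \<Longrightarrow> cmod (wirt i (\<lambda>w. \<omega> w {j} {k}) z) \<le> M"
    "\<And>z i j k. z \<in> \<Omega> \<Longrightarrow> cmod (wirt_bar i (\<lambda>w. \<omega> w {j} {k}) z) \<le> M"
    by (rule hermitian_metric_derivative_bound[OF \<omega> \<open>bounded \<Omega>\<close>]) blast+
  define C0 where "C0 = 16 * real CARD('n) ^ 17 * M\<^sup>2 / c ^ 3"
  have C0: "0 \<le> C0" using c(1) by (simp add: C0_def)
  have real11: "real_11_form_on UNIV \<omega>" using \<omega> by (simp add: hermitian_metric_def)
  show ?thesis
    \<comment> \<open>\<open>C0\<close> may vanish, for instance if the metric has constant coefficients; adding one makes it positive\<close>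
  proof (rule that[of "C0 + 1"])
    show "0 < C0 + 1" using C0 by simp
    fix \<gamma> :: "'n form" and h :: "(complex, 'n) vec \<Rightarrow> real" and z
    assume \<gamma>: "\<gamma> \<in> Gamma_cone \<Omega> \<omega> m" and h: "smooth_on \<Omega> h" and z: "z \<in> \<Omega>"
    define w y where "w = Alt (\<omega> z)" and "y = Alt (\<gamma> z)"
    have cw: "coeffs w = \<omega> z" and cy: "coeffs y = \<gamma> z" by (simp_all add: w_def y_def Alt_inverse)
    define a where "a j = wirt j (\<lambda>w. complex_of_real (h w)) z" for j
    define u where "u t i j k = (if t then - \<i> * wirt i (\<lambda>w. \<omega> w {j} {k}) z else \<i> * wirt_bar i (\<lambda>w. \<omega> w {j} {k}) z)"
      for t i j k
    define \<alpha> \<beta> where "\<alpha> = (\<Sum>j\<in>UNIV. a j *\<^sub>c gen True j)" and "\<beta> = (\<Sum>j\<in>UNIV. cnj (a j) *\<^sub>c gen False j)"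
    define \<eta> where "\<eta> = (\<Sum>t\<in>UNIV. \<Sum>i\<in>UNIV. \<Sum>j\<in>UNIV. \<Sum>k\<in>UNIV. u t i j k *\<^sub>c (gen t i * (gen True j * gen False k)))"
    have dh: "Alt (form_d (form_of_real_fun h) z) = \<alpha> + \<beta>"
      "Alt (form_dc (form_of_real_fun h) z) = \<i> *\<^sub>c (\<beta> - \<alpha>)"
      using smooth_on_imp_C1(1)[OF h z]
      by (simp_all add: Alt_d Alt_dc Alt_del_real_fun Alt_delbar_real_fun \<alpha>_def \<beta>_def a_def)
    have zero: "(\<lambda>w. \<omega> w K L) = (\<lambda>w. 0)" if "\<not> (card K = 1 \<and> card L = 1)" for K L
      using real11 that unfolding real_11_form_on_def by blast
    have D: "Alt (\<lambda>K L. D (\<lambda>w. \<omega> w K L)) = (\<Sum>j\<in>UNIV. \<Sum>k\<in>UNIV. D (\<lambda>w. \<omega> w {j} {k}) *\<^sub>c (gen True j * gen False k))"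
      if "D (\<lambda>w. 0) = 0" for D
    proof -
      have "card K = 1 \<and> card L = 1" if "coeffs (Alt (\<lambda>K L. D (\<lambda>w. \<omega> w K L))) K L \<noteq> 0" for K L
      proof (rule ccontr)
        assume no: "\<not> (card K = 1 \<and> card L = 1)"
        from that show False unfolding Alt_inverse[OF UNIV_I] zero[OF no] using \<open>D (\<lambda>w. 0) = 0\<close> by contradiction
      qed
      from alt_11_expansion[of "Alt (\<lambda>K L. D (\<lambda>w. \<omega> w K L))", OF this]
      show ?thesis by (simp add: Alt_inverse)
    qed
    have dc: "Alt (form_dc \<omega> z) = \<eta>"
    proof -
      have "Alt (form_dc \<omega> z) = \<i> *\<^sub>c (
          (\<Sum>i\<in>UNIV. \<Sum>j\<in>UNIV. \<Sum>k\<in>UNIV. wirt_bar i (\<lambda>w. \<omega> w {j} {k}) z *\<^sub>c (gen False i * (gen True j * gen False k)))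
        - (\<Sum>i\<in>UNIV. \<Sum>j\<in>UNIV. \<Sum>k\<in>UNIV. wirt i (\<lambda>w. \<omega> w {j} {k}) z *\<^sub>c (gen True i * (gen True j * gen False k))))"
        using D[of "\<lambda>f. wirt i f z" for i] D[of "\<lambda>f. wirt_bar i f z" for i]
        by (simp only: Alt_dc Alt_del Alt_delbar wirt_zero sum_distrib_left smul_mult)
      also have "\<dots> = \<eta>"
        unfolding \<eta>_def u_def diff_conv_add_uminus
        by (simp add: UNIV_bool smul_distribs(1) smul_sum(1) smul_distribs(6) flip: sum_negf)
      finally show ?thesis .
    qed
    have "0 < Re (dens (y ^ k * w ^ (CARD('n) - k)))" if "1 \<le> k" "k \<le> m" for k
      using \<gamma> z that by (auto simp: Gamma_cone_def ext_density_dens Alt_wedge Alt_pow w_def y_def)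
    moreover have "cmod (u t i j k) \<le> M" for t i j k
      using M(2,3)[OF z, of i j k] by (simp add: u_def norm_mult)
    moreover have "c * (norm v)\<^sup>2 \<le> Re (herm (\<lambda>i j. coeffs w {i} {j} / \<i>) v v)" for v
      using c(2)[OF z] by (simp only: cw)
    moreover have "card I = 1 \<and> card J = 1" if "coeffs w I J \<noteq> 0" for I J
      using real11 that unfolding cw real_11_form_on_def by blast
    moreover have "card I = 1 \<and> card J = 1" if "coeffs y I J \<noteq> 0" for I J
      using \<gamma> z that unfolding cy Gamma_cone_def real_11_form_on_def by blast
    moreover have "ext_cnj (coeffs w) = coeffs w" "ext_cnj (coeffs y) = coeffs y"
      using real11 \<gamma> z unfolding cw cy Gamma_cone_def real_11_form_on_def by blast+
    ultimately obtain A B where AB: "0 \<le> A" "0 \<le> B"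
      "dens ((\<alpha> + \<beta>) * (\<i> *\<^sub>c (\<beta> - \<alpha>) * (y ^ (m - 1) * w ^ (CARD('n) - m)))) = complex_of_real A"
      "dens (y ^ (m - 1) * w ^ (CARD('n) - m + 1)) = complex_of_real B"
      "(cmod (dens ((\<alpha> + \<beta>) * (\<eta> * (y ^ (m - 1) * w ^ (CARD('n) - m - 1))))))\<^sup>2 \<le> C0 * (A * B)"
      using pointwise_inequality[of w y c u M m a] c(1) m unfolding \<alpha>_def \<beta>_def \<eta>_def C0_def by blast
    have "C0 * (A * B) \<le> (C0 + 1) * (A * B)" using AB by (intro mult_right_mono) auto
    with AB show "\<exists>A B. 0 \<le> A \<and> 0 \<le> B \<and>
        ext_density ((form_d (form_of_real_fun h) \<and>\<^sub>F form_dc (form_of_real_fun h) \<and>\<^sub>F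
            \<gamma> ^\<^sub>F (m - 1) \<and>\<^sub>F \<omega> ^\<^sub>F (CARD('n) - m)) z) = complex_of_real A \<and>
        ext_density ((\<gamma> ^\<^sub>F (m - 1) \<and>\<^sub>F \<omega> ^\<^sub>F (CARD('n) - m + 1)) z) = complex_of_real B \<and>
        (cmod (ext_density ((form_d (form_of_real_fun h) \<and>\<^sub>F form_dc \<omega> \<and>\<^sub>F
            \<gamma> ^\<^sub>F (m - 1) \<and>\<^sub>F \<omega> ^\<^sub>F (CARD('n) - m - 1)) z)))\<^sup>2 \<le> (C0 + 1) * (A * B)"
      unfolding ext_density_dens Alt_wedge Alt_pow dh dc w_def[symmetric] y_def[symmetric]
      by (intro exI[of _ A] exI[of _ B]) (auto intro: order_trans)
  qed
qed

section \<open>Integration\<close>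

text \<open>Working with extended nonnegative integrals covers the case \<open>\<infinity> \<cdot> 0 = 0\<close> on the right-hand side: then
\<open>\<phi> \<psi> f\<close> vanishes almost everywhere.\<close>

lemma weighted_Cauchy_Schwarz:
  fixes f \<phi> \<psi> :: "'a::euclidean_space \<Rightarrow> complex" and A B :: "'a \<Rightarrow> real"
  assumes \<Omega>: "\<Omega> \<in> sets borel"
    and meas [measurable]: "\<phi> \<in> borel_measurable (restrict_space borel \<Omega>)" "\<psi> \<in> borel_measurable (restrict_space borel \<Omega>)"
      "f \<in> borel_measurable (restrict_space borel \<Omega>)" "A \<in> borel_measurable (restrict_space borel \<Omega>)"
      "B \<in> borel_measurable (restrict_space borel \<Omega>)"
    and A: "\<And>z. z \<in> \<Omega> \<Longrightarrow> 0 \<le> A z" and B: "\<And>z. z \<in> \<Omega> \<Longrightarrow> 0 \<le> B z" and C: "0 \<le> C"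
    and le: "\<And>z. z \<in> \<Omega> \<Longrightarrow> (cmod (f z))\<^sup>2 \<le> C * (A z * B z)"
  defines "R \<equiv> ennreal C * (\<integral>\<^sup>+z\<in>\<Omega>. ennreal ((cmod (\<phi> z))\<^sup>2 * A z) \<partial>lborel)
      * (\<integral>\<^sup>+z\<in>\<Omega>. ennreal ((cmod (\<psi> z))\<^sup>2 * B z) \<partial>lborel)"
  shows "R < top \<Longrightarrow> set_integrable lborel \<Omega> (\<lambda>z. \<phi> z * \<psi> z * f z)"
    and "ennreal ((cmod (LINT z:\<Omega>|lborel. \<phi> z * \<psi> z * f z))\<^sup>2) \<le> R"
proof -
  define F where "F z = indicator \<Omega> z *\<^sub>R (\<phi> z * \<psi> z * f z)" for z
  define p where "p z = ennreal (cmod (\<phi> z) * sqrt (A z)) * indicator \<Omega> z" for z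
  define q where "q z = ennreal (cmod (\<psi> z) * sqrt (B z)) * indicator \<Omega> z" for z
  have [measurable]: "F \<in> borel_measurable lborel"
    unfolding F_def using \<Omega> by (subst measurable_lborel2, subst borel_measurable_restrict_space_iff[symmetric]) auto
  have [measurable]: "p \<in> borel_measurable lborel" "q \<in> borel_measurable lborel"
    unfolding p_def q_def using \<Omega>
    by (subst measurable_lborel2, subst borel_measurable_restrict_space_iff_ennreal[symmetric]; auto)+
  define N where "N = (\<integral>\<^sup>+z. ennreal (norm (F z)) \<partial>lborel)"
  have "ennreal (norm (F z)) \<le> ennreal (sqrt C) * (p z * q z)" for z
  proof (cases "z \<in> \<Omega>")
    case True
    have "cmod (f z) \<le> sqrt (C * (A z * B z))" using le[OF True] by (rule real_le_rsqrt)
    then have "cmod (\<phi> z) * cmod (\<psi> z) * cmod (f z) \<le> cmod (\<phi> z) * cmod (\<psi> z) * sqrt (C * (A z * B z))"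
      by (intro mult_left_mono) auto
    also have "\<dots> = sqrt C * ((cmod (\<phi> z) * sqrt (A z)) * (cmod (\<psi> z) * sqrt (B z)))"
      by (simp add: real_sqrt_mult)
    finally show ?thesis
      using True A[OF True] B[OF True] C by (simp add: F_def p_def q_def norm_mult flip: ennreal_mult)
  qed (simp add: F_def)
  then have "N \<le> (\<integral>\<^sup>+z. ennreal (sqrt C) * (p z * q z) \<partial>lborel)"
    unfolding N_def by (intro nn_integral_mono)
  also have "\<dots> = ennreal (sqrt C) * (\<integral>\<^sup>+z. p z * q z \<partial>lborel)" by (intro nn_integral_cmult) simp
  finally have "N\<^sup>2 \<le> (ennreal (sqrt C) * (\<integral>\<^sup>+z. p z * q z \<partial>lborel))\<^sup>2" by (intro power_mono) auto
  also have "\<dots> = ennreal C * (\<integral>\<^sup>+z. p z * q z \<partial>lborel)\<^sup>2"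
    using C by (simp add: power_mult_distrib ennreal_power)
  also have "\<dots> \<le> ennreal C * ((\<integral>\<^sup>+z. (p z)\<^sup>2 \<partial>lborel) * (\<integral>\<^sup>+z. (q z)\<^sup>2 \<partial>lborel))"
    by (intro mult_left_mono Cauchy_Schwarz_nn_integral) auto
  also have "(\<integral>\<^sup>+z. (p z)\<^sup>2 \<partial>lborel) = (\<integral>\<^sup>+z\<in>\<Omega>. ennreal ((cmod (\<phi> z))\<^sup>2 * A z) \<partial>lborel)"
    using A by (intro nn_integral_cong) (auto simp: p_def power_mult_distrib ennreal_power indicator_def)
  also have "(\<integral>\<^sup>+z. (q z)\<^sup>2 \<partial>lborel) = (\<integral>\<^sup>+z\<in>\<Omega>. ennreal ((cmod (\<psi> z))\<^sup>2 * B z) \<partial>lborel)"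
    using B by (intro nn_integral_cong) (auto simp: q_def power_mult_distrib ennreal_power indicator_def)
  finally have NR: "N\<^sup>2 \<le> R" by (simp add: R_def mult.assoc)
  show "set_integrable lborel \<Omega> (\<lambda>z. \<phi> z * \<psi> z * f z)" if "R < top"
  proof -
    have "N\<^sup>2 < top" using NR that by (rule le_less_trans)
    then have "N < top" by (cases "N = top") (auto simp: top.not_eq_extremum)
    then show ?thesis
      unfolding set_integrable_def F_def[symmetric] integrable_iff_bounded N_def by simp
  qed
  have "ennreal (norm (LINT z|lborel. F z)) \<le> N"
  proof (cases "integrable lborel F")
    case True
    then show ?thesis unfolding N_def by (rule integral_norm_bound_ennreal)
  qed (simp add: not_integrable_integral_eq)
  then have "(ennreal (norm (LINT z|lborel. F z)))\<^sup>2 \<le> N\<^sup>2" by (intro power_mono) auto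
  then show "ennreal ((cmod (LINT z:\<Omega>|lborel. \<phi> z * \<psi> z * f z))\<^sup>2) \<le> R"
    using NR by (simp add: set_lebesgue_integral_def F_def ennreal_power)
qed

text \<open>For a nonnegative density the subtracted integral of the negative part is zero.\<close>

lemma form_integral_ereal_nonneg:
  assumes "\<And>z. z \<in> \<Omega> \<Longrightarrow> ext_density (\<alpha> z) = complex_of_real (A z)" "\<And>z. z \<in> \<Omega> \<Longrightarrow> 0 \<le> A z"
  shows "form_integral_ereal \<Omega> ((\<lambda>z. complex_of_real ((cmod (\<phi> z))\<^sup>2)) \<cdot>\<^sub>F \<alpha>)
    = enn2ereal (\<integral>\<^sup>+z\<in>\<Omega>. ennreal ((cmod (\<phi> z))\<^sup>2 * A z) \<partial>lborel)"
proof -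
  have d: "Re (ext_density (((\<lambda>z. complex_of_real ((cmod (\<phi> z))\<^sup>2)) \<cdot>\<^sub>F \<alpha>) z)) = (cmod (\<phi> z))\<^sup>2 * A z" if "z \<in> \<Omega>" for z
  proof -
    have "ext_density (((\<lambda>z. complex_of_real ((cmod (\<phi> z))\<^sup>2)) \<cdot>\<^sub>F \<alpha>) z) = complex_of_real ((cmod (\<phi> z))\<^sup>2) * ext_density (\<alpha> z)"
      by (simp add: form_scale_def ext_density_def)
    then show ?thesis using assms(1)[OF that] by (simp flip: of_real_mult of_real_power)
  qed
  let ?g = "\<lambda>z. Re (ext_density (((\<lambda>z. complex_of_real ((cmod (\<phi> z))\<^sup>2)) \<cdot>\<^sub>F \<alpha>) z))"
  have "(\<integral>\<^sup>+z\<in>\<Omega>. ennreal (?g z) \<partial>lborel) = (\<integral>\<^sup>+z\<in>\<Omega>. ennreal ((cmod (\<phi> z))\<^sup>2 * A z) \<partial>lborel)"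
    by (intro nn_integral_cong) (auto simp: indicator_def d simp del: of_real_power)
  moreover have "(\<integral>\<^sup>+z\<in>\<Omega>. ennreal (- ?g z) \<partial>lborel) = (\<integral>\<^sup>+z. 0 \<partial>(lborel :: (complex ^ 'a) measure))"
    using assms(2) by (intro nn_integral_cong) (auto simp: indicator_def d ennreal_neg simp del: of_real_power)
  ultimately show ?thesis by (simp add: form_integral_ereal_def zero_ennreal.rep_eq)
qed

theorem lemma2p4:
  fixes \<Omega> :: "(complex ^ 'n::{finite,linorder}) set"
    and \<omega> :: "'n::{finite,linorder} form"
    and m :: nat
  assumes "hermitian_metric \<omega>"
    and "open \<Omega>" and "bounded \<Omega>"
    and "1 \<le> m" and "m \<le> CARD('n) - 1"
  shows "\<exists>C::real. C > 0 \<and>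
    (\<forall>\<gamma> \<in> Gamma_cone \<Omega> \<omega> m. \<forall>(h :: _ \<Rightarrow> real) (\<phi> :: _ \<Rightarrow> complex) (\<psi> :: _ \<Rightarrow> complex).
      smooth_on \<Omega> h \<longrightarrow>
      \<phi> \<in> borel_measurable (restrict_space borel \<Omega>) \<longrightarrow>
      \<psi> \<in> borel_measurable (restrict_space borel \<Omega>) \<longrightarrow>
      (let dh = form_d (form_of_real_fun h);
           dch = form_dc (form_of_real_fun h);
           L = (\<lambda>z. \<phi> z * \<psi> z) \<cdot>\<^sub>F
                 (dh \<and>\<^sub>F form_dc \<omega> \<and>\<^sub>F \<gamma> ^\<^sub>F (m - 1) \<and>\<^sub>F \<omega> ^\<^sub>F (CARD('n) - m - 1));
           R = ereal C
               * form_integral_ereal \<Omega> ((\<lambda>z. complex_of_real ((cmod (\<phi> z))\<^sup>2)) \<cdot>\<^sub>F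
                   (dh \<and>\<^sub>F dch \<and>\<^sub>F \<gamma> ^\<^sub>F (m - 1) \<and>\<^sub>F \<omega> ^\<^sub>F (CARD('n) - m)))
               * form_integral_ereal \<Omega> ((\<lambda>z. complex_of_real ((cmod (\<psi> z))\<^sup>2)) \<cdot>\<^sub>F
                   (\<gamma> ^\<^sub>F (m - 1) \<and>\<^sub>F \<omega> ^\<^sub>F (CARD('n) - m + 1)))
       in (R < \<infinity> \<longrightarrow> form_integrable \<Omega> L) \<and>
          ereal ((cmod (form_integral \<Omega> L))\<^sup>2) \<le> R))"
proof -
  obtain C where C: "0 < C" and pointwise: "\<And>\<gamma> h z. \<gamma> \<in> Gamma_cone \<Omega> \<omega> m \<Longrightarrow> smooth_on \<Omega> h \<Longrightarrow> z \<in> \<Omega> \<Longrightarrow>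
      \<exists>A B. 0 \<le> A \<and> 0 \<le> B \<and>
        ext_density ((form_d (form_of_real_fun h) \<and>\<^sub>F form_dc (form_of_real_fun h) \<and>\<^sub>F
            \<gamma> ^\<^sub>F (m - 1) \<and>\<^sub>F \<omega> ^\<^sub>F (CARD('n) - m)) z) = complex_of_real A \<and>
        ext_density ((\<gamma> ^\<^sub>F (m - 1) \<and>\<^sub>F \<omega> ^\<^sub>F (CARD('n) - m + 1)) z) = complex_of_real B \<and>
        (cmod (ext_density ((form_d (form_of_real_fun h) \<and>\<^sub>F form_dc \<omega> \<and>\<^sub>F
            \<gamma> ^\<^sub>F (m - 1) \<and>\<^sub>F \<omega> ^\<^sub>F (CARD('n) - m - 1)) z)))\<^sup>2 \<le> C * (A * B)"
    by (rule pointwise_form_inequality[OF assms(1,3,4,5)]) blast+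
  show ?thesis
    unfolding Let_def
  proof (intro exI[of _ C] conjI[OF C] ballI allI impI)
    fix \<gamma> :: "'n form" and h :: "(complex, 'n) vec \<Rightarrow> real" and \<phi> \<psi> :: "(complex, 'n) vec \<Rightarrow> complex"
    assume \<gamma>: "\<gamma> \<in> Gamma_cone \<Omega> \<omega> m" and h: "smooth_on \<Omega> h"
      and [measurable]: "\<phi> \<in> borel_measurable (restrict_space borel \<Omega>)" "\<psi> \<in> borel_measurable (restrict_space borel \<Omega>)"
    let ?\<mu> = "form_d (form_of_real_fun h) \<and>\<^sub>F form_dc \<omega> \<and>\<^sub>F \<gamma> ^\<^sub>F (m - 1) \<and>\<^sub>F \<omega> ^\<^sub>F (CARD('n) - m - 1)"
    let ?\<alpha> = "form_d (form_of_real_fun h) \<and>\<^sub>F form_dc (form_of_real_fun h) \<and>\<^sub>F \<gamma> ^\<^sub>F (m - 1) \<and>\<^sub>F \<omega> ^\<^sub>F (CARD('n) - m)"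
    let ?\<beta> = "\<gamma> ^\<^sub>F (m - 1) \<and>\<^sub>F \<omega> ^\<^sub>F (CARD('n) - m + 1)"
    define f A B where "f z = ext_density (?\<mu> z)" and "A z = Re (ext_density (?\<alpha> z))"
      and "B z = Re (ext_density (?\<beta> z))" for z
    have "smooth_form_on UNIV \<omega>" using assms(1) by (simp add: hermitian_metric_def)
    then have \<omega>: "continuous_form_on \<Omega> \<omega>" "continuous_form_on \<Omega> (form_dc \<omega>)"
      by (auto intro: continuous_form_on_subset[where S = UNIV] continuous_form_on_smooth continuous_form_on_d_dc_smooth)
    have "continuous_form_on \<Omega> \<gamma>"
      using \<gamma> by (auto simp: Gamma_cone_def intro: continuous_form_on_smooth)
    then have cont: "continuous_on \<Omega> f" "continuous_on \<Omega> A" "continuous_on \<Omega> B"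
      unfolding f_def A_def B_def
      by (intro continuous_intros continuous_on_density continuous_form_on_wedge continuous_form_on_pow
          continuous_form_on_d_dc_real_fun h \<omega>; assumption)+
    have pt: "0 \<le> A z" "0 \<le> B z" "ext_density (?\<alpha> z) = complex_of_real (A z)"
       "ext_density (?\<beta> z) = complex_of_real (B z)" "(cmod (f z))\<^sup>2 \<le> C * (A z * B z)" if "z \<in> \<Omega>" for z
      using pointwise[OF \<gamma> h that] by (auto simp: f_def A_def B_def)
    let ?IA = "\<integral>\<^sup>+z\<in>\<Omega>. ennreal ((cmod (\<phi> z))\<^sup>2 * A z) \<partial>lborel"
    let ?IB = "\<integral>\<^sup>+z\<in>\<Omega>. ennreal ((cmod (\<psi> z))\<^sup>2 * B z) \<partial>lborel"
    let ?R = "ereal C * form_integral_ereal \<Omega> ((\<lambda>z. complex_of_real ((cmod (\<phi> z))\<^sup>2)) \<cdot>\<^sub>F ?\<alpha>)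
        * form_integral_ereal \<Omega> ((\<lambda>z. complex_of_real ((cmod (\<psi> z))\<^sup>2)) \<cdot>\<^sub>F ?\<beta>)"
    have R: "?R = enn2ereal (ennreal C * ?IA * ?IB)"
      using form_integral_ereal_nonneg[of \<Omega> ?\<alpha> A \<phi>] form_integral_ereal_nonneg[of \<Omega> ?\<beta> B \<psi>] pt C
      by (simp add: times_ennreal.rep_eq enn2ereal_ennreal)
    have L: "ext_density (((\<lambda>z. \<phi> z * \<psi> z) \<cdot>\<^sub>F ?\<mu>) z) = \<phi> z * \<psi> z * f z" for z
      by (simp add: f_def form_scale_def ext_density_def)
    have \<Omega>: "\<Omega> \<in> sets borel" using \<open>open \<Omega>\<close> by simp
    note CS = weighted_Cauchy_Schwarz[OF \<Omega> _ _ cont[THEN borel_measurable_continuous_on_restrict] pt(1,2) less_imp_le[OF C] pt(5), of \<phi> \<psi>]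
    have int: "form_integrable \<Omega> ((\<lambda>z. \<phi> z * \<psi> z) \<cdot>\<^sub>F ?\<mu>)" if "?R < \<infinity>"
    proof -
      have "ennreal C * ?IA * ?IB < top" using that unfolding R less_ennreal.rep_eq by (simp add: top_ennreal.rep_eq top_ereal_def)
      then show ?thesis unfolding form_integrable_def L by (intro CS(1)) auto
    qed
    have "ennreal ((cmod (form_integral \<Omega> ((\<lambda>z. \<phi> z * \<psi> z) \<cdot>\<^sub>F ?\<mu>)))\<^sup>2) \<le> ennreal C * ?IA * ?IB"
      unfolding form_integral_def L by (intro CS(2)) auto
    then have "enn2ereal (ennreal ((cmod (form_integral \<Omega> ((\<lambda>z. \<phi> z * \<psi> z) \<cdot>\<^sub>F ?\<mu>)))\<^sup>2)) \<le> ?R"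
      unfolding R by (simp only: less_eq_ennreal.rep_eq)
    then have "ereal ((cmod (form_integral \<Omega> ((\<lambda>z. \<phi> z * \<psi> z) \<cdot>\<^sub>F ?\<mu>)))\<^sup>2) \<le> ?R"
      by (simp add: enn2ereal_ennreal)
    with int show "(?R < \<infinity> \<longrightarrow> form_integrable \<Omega> ((\<lambda>z. \<phi> z * \<psi> z) \<cdot>\<^sub>F ?\<mu>)) \<and>
        ereal ((cmod (form_integral \<Omega> ((\<lambda>z. \<phi> z * \<psi> z) \<cdot>\<^sub>F ?\<mu>)))\<^sup>2) \<le> ?R"
      by (intro conjI impI)
  qed
qed

end
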